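(* Let $q>3$ be a prime power. The ideal $$\mathcal{J}_q+\langle x_{ij}-x_{ji}\colon 0\le i<j\le q-2\rangle\subset\mathbb{F}_q[\overline{X}_q]$$ is zero-dimensional and radical, and its algebraic set is identified with $\mathcal{SLP}_q$, via the bijection $(s_{ij})_{0\le i,j\le q-2}\mapsto\sum_{i,j=0}^{q-2}s_{ij}x^iy^j$. If $\mathcal{J}_q$ is replaced by $\mathcal{J}_{q,d}$ (for a nonnegative integer $d$), then the algebraic set of the resulting zero-dimensional radical ideal is identified in the same way with $\mathcal{SLP}_{q,d}$.
   Context: $\mathbb{F}_q$ is the finite field with $q$ elements. $\mathcal{LP}_q$ is the set of local permutation polynomials: polynomials $f\in\mathbb{F}_q[x,y]$ of degree less than $q$ in each variable such that, for every $a\in\mathbb{F}_q$, both $f(x,a)$ and $f(a,x)$ act as permutations of $\mathbb{F}_q$; $\mathcal{LP}_{q,d}$ is the subset of those of total degree $d$. $\mathcal{SLP}_q$ and $\mathcal{SLP}_{q,d}$ are the subsets of symmetric polynomials ($f(x,y)=f(y,x)$) in $\mathcal{LP}_q$ and $\mathcal{LP}_{q,d}$, respectively. $\overline{X}_q:=\{x_{ij}\colon 0\le i,j\le q-2\}$ is a set of variables (all indices below range over $\{0,\ldots,q-2\}$; an empty product is $1$). Put $F(x):=x^{q-1}-1$ and, for $a,b,c\in\mathbb{F}_q$ with $a\ne b$ (with $0^0=1$), $G^{\mathrm{row}}_{a,b,c}:=F(\sum_{i,j=0}^{q-2}(a^i-b^i)c^jx_{ji})$, $G^{\mathrm{col}}_{a,b,c}:=F(\sum_{i,j=0}^{q-2}(a^i-b^i)c^jx_{ij})$.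 Then $$\mathcal{J}_q:=\langle G^{\mathrm{row}}_{a,b,c},\,G^{\mathrm{col}}_{a,b,c}\colon a,b,c\in\mathbb{F}_q,\ a\neq b\rangle+\langle x_{ij}^q-x_{ij}\colon 0\le i,j\le q-2\rangle,$$ $$\mathcal{J}_{q,d}:=\mathcal{J}_q+\langle x_{ij}\colon i+j>d\rangle+\Big\langle\prod_{i+j=d}(x_{ij}^{q-1}-1)\Big\rangle.$$ The algebraic set of an ideal $I$ of a polynomial ring over $\mathbb{F}_q$ in $n$ variables is the set of points of $\mathbb{F}_q^n$ at which all elements of $I$ vanish; $I$ is zero-dimensional if the quotient ring by $I$ is a finite-dimensional $\mathbb{F}_q$-vector space. *)

theory Defs
  imports "HOL-Algebra.Embedded_Algebras" "HOL-Library.Poly_Mapping"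
    "HOL-Library.Cardinality"
begin

section \<open>Multivariate polynomials\<close>

text \<open>
  A polynomial is the finitely supported family of its coefficients, indexed by monomials, and a
  monomial is the finitely supported family of its exponents. The ring operations are those of
  the type class instances in \<^theory>\<open>HOL-Library.Poly_Mapping\<close>.
\<close>

type_synonym ('v, 'a) mpoly = "('v \<Rightarrow>\<^sub>0 nat) \<Rightarrow>\<^sub>0 'a"

definition pconst :: "'a::zero \<Rightarrow> ('v, 'a) mpoly" where
  "pconst c = Poly_Mapping.single 0 c"

definition pvar :: "'v \<Rightarrow> ('v, 'a::zero_neq_one) mpoly" where
  "pvar v = Poly_Mapping.single (Poly_Mapping.single v 1) 1"

definition pvars :: "('v, 'a::zero) mpoly \<Rightarrow> 'v set" where
  "pvars p = (\<Union>m\<in>Poly_Mapping.keys p. Poly_Mapping.keys m)"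

text \<open>Apply \<open>h\<close> to the coefficients and substitute \<open>\<phi> v\<close> for each variable \<open>v\<close>.\<close>

definition psubst ::
  "('a::zero \<Rightarrow> 'b::comm_semiring_1) \<Rightarrow> ('v \<Rightarrow> 'b) \<Rightarrow> ('v, 'a) mpoly \<Rightarrow> 'b" where
  "psubst h \<phi> p = (\<Sum>m\<in>Poly_Mapping.keys p. h (Poly_Mapping.lookup p m) * (\<Prod>v\<in>Poly_Mapping.keys m. \<phi> v ^ Poly_Mapping.lookup m v))"

abbreviation peval :: "('v \<Rightarrow> 'a::comm_semiring_1) \<Rightarrow> ('v, 'a) mpoly \<Rightarrow> 'a" where
  "peval \<equiv> psubst (\<lambda>c. c)"

text \<open>Both degrees of the zero polynomial are \<open>0\<close> by convention.\<close>

definition degree_in :: "'v \<Rightarrow> ('v, 'a::zero) mpoly \<Rightarrow> nat" where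
  "degree_in v p = Max (insert 0 ((\<lambda>m. Poly_Mapping.lookup m v) ` Poly_Mapping.keys p))"

definition total_degree :: "('v, 'a::zero) mpoly \<Rightarrow> nat" where
  "total_degree p = Max (insert 0 ((\<lambda>m. \<Sum>v\<in>Poly_Mapping.keys m. Poly_Mapping.lookup m v) ` Poly_Mapping.keys p))"

text \<open>The polynomial ring in the variables from \<open>V\<close>, as a ring with carrier.\<close>

definition poly_ring :: "'v set \<Rightarrow> ('v, 'a::comm_ring_1) mpoly ring" where
  "poly_ring V = \<lparr>carrier = {p. pvars p \<subseteq> V}, mult = (*), one = 1, zero = 0, add = (+)\<rparr>"

definition radical_ideal :: "('r, 'm) ring_scheme \<Rightarrow> 'r set \<Rightarrow> bool" where
  "radical_ideal R I \<longleftrightarrow>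
     ideal I R \<and> {p \<in> carrier R. \<exists>n::nat. n > 0 \<and> p [^]\<^bsub>R\<^esub> n \<in> I} = I"

text \<open>
  The scalars of the quotient algebra are the residue classes of the constant polynomials. For
  the unit ideal the quotient is the zero ring, which has dimension \<open>0\<close>, so the unit ideal is
  zero-dimensional.
\<close>

definition zero_dimensional_ideal :: "'v set \<Rightarrow> ('v, 'a::field) mpoly set \<Rightarrow> bool" where
  "zero_dimensional_ideal V I \<longleftrightarrow>
     ideal I (poly_ring V) \<and>
     ring.finite_dimension (poly_ring V Quot I)
       (range (\<lambda>c. I +>\<^bsub>poly_ring V\<^esub> pconst c)) (carrier (poly_ring V Quot I))"

text \<open>Points are functions on \<open>V\<close>, extended by \<^const>\<open>undefined\<close> outside \<open>V\<close>.\<close>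

definition algebraic_set :: "'v set \<Rightarrow> ('v, 'a::field) mpoly set \<Rightarrow> ('v \<Rightarrow> 'a) set" where
  "algebraic_set V I = {s \<in> V \<rightarrow>\<^sub>E UNIV. \<forall>p\<in>I. peval s p = 0}"


section \<open>Local permutation polynomials\<close>

text \<open>
  The field with \<open>q\<close> elements is a type \<open>'a\<close> of classes \<^class>\<open>field\<close> and \<^class>\<open>finite\<close>
  with \<open>q = CARD('a)\<close>.
\<close>

datatype xy = X | Y

text \<open>\<open>bisubst h u w f\<close> is \<open>f(u, w)\<close>.\<close>

abbreviation bisubst ::
  "('a::zero \<Rightarrow> 'b::comm_semiring_1) \<Rightarrow> 'b \<Rightarrow> 'b \<Rightarrow> (xy, 'a) mpoly \<Rightarrow> 'b" where
  "bisubst h u w \<equiv> psubst h (case_xy u w)"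

definition LP :: "(xy, 'a::{field,finite}) mpoly set" where
  "LP = {f. degree_in X f < CARD('a) \<and> degree_in Y f < CARD('a) \<and>
            (\<forall>a. bij (\<lambda>u. bisubst (\<lambda>c. c) u a f) \<and> bij (\<lambda>u. bisubst (\<lambda>c. c) a u f))}"

definition LP_deg :: "nat \<Rightarrow> (xy, 'a::{field,finite}) mpoly set" where
  "LP_deg d = {f \<in> LP. total_degree f = d}"

definition symmetric_poly :: "(xy, 'a::comm_ring_1) mpoly \<Rightarrow> bool" where
  "symmetric_poly f \<longleftrightarrow>
     bisubst pconst (pvar X) (pvar Y) f = bisubst pconst (pvar Y) (pvar X) f"

definition SLP :: "(xy, 'a::{field,finite}) mpoly set" where
  "SLP = {f \<in> LP. symmetric_poly f}"

definition SLP_deg :: "nat \<Rightarrow> (xy, 'a::{field,finite}) mpoly set" where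
  "SLP_deg d = {f \<in> LP_deg d. symmetric_poly f}"


section \<open>The ideals\<close>

text \<open>
  The variable \<open>x\<^sub>i\<^sub>j\<close> is \<open>pvar (i, j)\<close>. The argument of type \<open>'a itself\<close> only carries the
  field, through which \<open>q = CARD('a)\<close> enters.
\<close>

definition idx :: "'a::{field,finite} itself \<Rightarrow> nat set" where
  "idx _ = {0..CARD('a) - 2}"

definition Xq :: "'a::{field,finite} itself \<Rightarrow> (nat \<times> nat) set" where
  "Xq F = idx F \<times> idx F"

abbreviation Rq :: "(nat \<times> nat, 'a::{field,finite}) mpoly ring" where
  "Rq \<equiv> poly_ring (Xq TYPE('a))"

definition F_poly :: "('v, 'a::{field,finite}) mpoly \<Rightarrow> ('v, 'a) mpoly" where
  "F_poly p = p ^ (CARD('a) - 1) - 1"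

text \<open>
  For the polynomial \<open>f\<close> with coefficients \<open>x\<^sub>i\<^sub>j\<close>, the arguments of \<open>F_poly\<close> are
  \<open>f(c, a) - f(c, b)\<close> in \<open>G_row\<close> and \<open>f(a, c) - f(b, c)\<close> in \<open>G_col\<close>.
\<close>

definition G_row :: "'a \<Rightarrow> 'a \<Rightarrow> 'a \<Rightarrow> (nat \<times> nat, 'a::{field,finite}) mpoly" where
  "G_row a b c =
     F_poly (\<Sum>i\<in>idx TYPE('a). \<Sum>j\<in>idx TYPE('a). pconst ((a ^ i - b ^ i) * c ^ j) * pvar (j, i))"

definition G_col :: "'a \<Rightarrow> 'a \<Rightarrow> 'a \<Rightarrow> (nat \<times> nat, 'a::{field,finite}) mpoly" where
  "G_col a b c =
     F_poly (\<Sum>i\<in>idx TYPE('a). \<Sum>j\<in>idx TYPE('a). pconst ((a ^ i - b ^ i) * c ^ j) * pvar (i, j))"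

definition J :: "(nat \<times> nat, 'a::{field,finite}) mpoly set" where
  "J = Idl\<^bsub>Rq\<^esub> ({G_row a b c | a b c. a \<noteq> b} \<union> {G_col a b c | a b c. a \<noteq> b})
       <+>\<^bsub>Rq\<^esub> Idl\<^bsub>Rq\<^esub> {pvar (i, j) ^ CARD('a) - pvar (i, j) | i j. (i, j) \<in> Xq TYPE('a)}"

definition J_deg :: "nat \<Rightarrow> (nat \<times> nat, 'a::{field,finite}) mpoly set" where
  "J_deg d = J
     <+>\<^bsub>Rq\<^esub> Idl\<^bsub>Rq\<^esub> {pvar (i, j) | i j. (i, j) \<in> Xq TYPE('a) \<and> i + j > d}
     <+>\<^bsub>Rq\<^esub> Idl\<^bsub>Rq\<^esub> {\<Prod>(i, j)\<in>{(i, j) \<in> Xq TYPE('a). i + j = d}. (pvar (i, j) ^ (CARD('a) - 1) - 1)}"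

definition Sym_ideal :: "(nat \<times> nat, 'a::{field,finite}) mpoly set" where
  "Sym_ideal = Idl\<^bsub>Rq\<^esub> {pvar (i, j) - pvar (j, i) | i j. (i, j) \<in> Xq TYPE('a) \<and> i < j}"

definition SJ :: "(nat \<times> nat, 'a::{field,finite}) mpoly set" where
  "SJ = J <+>\<^bsub>Rq\<^esub> Sym_ideal"

definition SJ_deg :: "nat \<Rightarrow> (nat \<times> nat, 'a::{field,finite}) mpoly set" where
  "SJ_deg d = J_deg d <+>\<^bsub>Rq\<^esub> Sym_ideal"

definition poly_of_point :: "(nat \<times> nat \<Rightarrow> 'a::{field,finite}) \<Rightarrow> (xy, 'a) mpoly" where
  "poly_of_point s =
     (\<Sum>i\<in>idx TYPE('a). \<Sum>j\<in>idx TYPE('a). pconst (s (i, j)) * pvar X ^ i * pvar Y ^ j)"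

end

theory Submission
  imports Defs "HOL-Computational_Algebra.Polynomial" "HOL-Number_Theory.Residues"
begin

text \<open>
  Every ideal that contains all \<open>x\<^sup>q - x\<close> is radical and zero-dimensional. Indeed, modulo
  such an ideal every monomial reduces to one with exponents below \<open>q\<close>, which gives a finite
  spanning set, and some power \<open>N \<ge> 2\<close> satisfies \<open>p\<^sup>N \<equiv> p\<close> for all polynomials
  \<open>p\<close>; if \<open>p\<^sup>n\<close> lies in the ideal, then so does a higher iterate of this \<open>N\<close>-th
  power, hence \<open>p\<close> itself.

  For the bijections, the generators express at a point exactly the injectivity of all the functions
  \<open>f(-, a)\<close> and \<open>f(a, -)\<close>, the symmetry of the coefficients, and the condition on the total
  degree. Surjectivity needs that a local permutation polynomial has no monomial of degree \<open>q - 1\<close> in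
  one variable: summing a permutation over the field gives \<open>0\<close>, and the same sum is minus the
  coefficient of degree \<open>q - 1\<close>.
\<close>

section \<open>Substitution into polynomials\<close>

lemma poly_mapping_eq_sum_single:
  "p = (\<Sum>m\<in>Poly_Mapping.keys p. Poly_Mapping.single m (Poly_Mapping.lookup p m))"
proof (rule poly_mapping_eqI)
  fix k
  show "Poly_Mapping.lookup p k =
    Poly_Mapping.lookup (\<Sum>m\<in>Poly_Mapping.keys p. Poly_Mapping.single m (Poly_Mapping.lookup p m)) k"
    by (auto simp: lookup_sum lookup_single when_def sum.delta in_keys_iff)
qed

definition monom_eval :: "('v \<Rightarrow> 'b::comm_semiring_1) \<Rightarrow> ('v \<Rightarrow>\<^sub>0 nat) \<Rightarrow> 'b" where
  "monom_eval \<phi> m = (\<Prod>v\<in>Poly_Mapping.keys m. \<phi> v ^ Poly_Mapping.lookup m v)"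

text \<open>Extra variables contribute zeroth powers. Monomials with different supports can thus be
  multiplied over one common index set.\<close>

lemma monom_eval_superset:
  assumes "finite A" "Poly_Mapping.keys m \<subseteq> A"
  shows "monom_eval \<phi> m = (\<Prod>v\<in>A. \<phi> v ^ Poly_Mapping.lookup m v)"
  unfolding monom_eval_def using assms
  by (intro prod.mono_neutral_left) (auto simp: in_keys_iff)

lemma monom_eval_0 [simp]: "monom_eval \<phi> 0 = 1"
  by (simp add: monom_eval_def)

lemma monom_eval_single: "monom_eval \<phi> (Poly_Mapping.single v n) = \<phi> v ^ n"
  by (simp add: monom_eval_def)

lemma monom_eval_add: "monom_eval \<phi> (m + n) = monom_eval \<phi> m * monom_eval \<phi> n"
proof -
  let ?A = "Poly_Mapping.keys m \<union> Poly_Mapping.keys n"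
  have "monom_eval \<phi> (m + n) = (\<Prod>v\<in>?A. \<phi> v ^ Poly_Mapping.lookup (m + n) v)"
    by (rule monom_eval_superset) (auto simp: in_keys_iff lookup_add)
  also have "\<dots> = (\<Prod>v\<in>?A. \<phi> v ^ Poly_Mapping.lookup m v) * (\<Prod>v\<in>?A. \<phi> v ^ Poly_Mapping.lookup n v)"
    by (simp add: lookup_add power_add prod.distrib)
  also have "\<dots> = monom_eval \<phi> m * monom_eval \<phi> n"
    by (subst (1 2) monom_eval_superset[of ?A]) auto
  finally show ?thesis .
qed

lemma psubst_eq: "psubst h \<phi> p = (\<Sum>m\<in>Poly_Mapping.keys p. h (Poly_Mapping.lookup p m) * monom_eval \<phi> m)"
  by (simp add: psubst_def monom_eval_def)

text \<open>Two instances are used: the identity, for values at a point, and \<open>pconst\<close>,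
  for substituting polynomials into polynomials. One proof that substitution is a ring homomorphism
  covers both.\<close>

locale coeff_hom =
  fixes h :: "'a::comm_ring_1 \<Rightarrow> 'b::comm_ring_1"
  assumes h_0: "h 0 = 0" and h_1: "h 1 = 1"
    and h_add: "\<And>a b. h (a + b) = h a + h b" and h_mult: "\<And>a b. h (a * b) = h a * h b"
begin

lemma psubst_single: "psubst h \<phi> (Poly_Mapping.single m c) = h c * monom_eval \<phi> m"
  by (cases "c = 0") (auto simp: psubst_eq h_0)

lemma psubst_pconst: "psubst h \<phi> (pconst c) = h c"
  by (simp add: pconst_def psubst_single)

lemma psubst_pvar: "psubst h \<phi> (pvar v) = \<phi> v"
  by (simp add: pvar_def psubst_single h_1 monom_eval_single)

lemma psubst_0: "psubst h \<phi> 0 = 0"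
  by (simp add: psubst_def)

lemma psubst_1: "psubst h \<phi> 1 = 1"
  using psubst_pconst[of \<phi> 1] by (simp add: h_1 pconst_def)

lemma psubst_add: "psubst h \<phi> (p + q) = psubst h \<phi> p + psubst h \<phi> q"
  unfolding psubst_eq by (rule setsum_keys_plus_distrib) (auto simp: h_0 h_add algebra_simps)

lemma psubst_sum: "psubst h \<phi> (sum f A) = (\<Sum>x\<in>A. psubst h \<phi> (f x))"
  by (induction A rule: infinite_finite_induct) (auto simp: psubst_0 psubst_add)

text \<open>Both factors are expanded into monomials, where the claim is \<open>h_mult\<close>
  together with \<open>monom_eval_add\<close>; the rest is bilinearity.\<close>

lemma psubst_mult: "psubst h \<phi> (p * q) = psubst h \<phi> p * psubst h \<phi> q"
proof -
  let ?p = "Poly_Mapping.lookup p" and ?q = "Poly_Mapping.lookup q"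
  let ?P = "Poly_Mapping.keys p" and ?Q = "Poly_Mapping.keys q"
  have "p * q = (\<Sum>m\<in>?P. Poly_Mapping.single m (?p m)) * (\<Sum>n\<in>?Q. Poly_Mapping.single n (?q n))"
    using poly_mapping_eq_sum_single[of p] poly_mapping_eq_sum_single[of q] by simp
  also have "\<dots> = (\<Sum>m\<in>?P. \<Sum>n\<in>?Q. Poly_Mapping.single (m + n) (?p m * ?q n))"
    by (simp add: sum_product mult_single)
  finally have "psubst h \<phi> (p * q) =
      (\<Sum>m\<in>?P. \<Sum>n\<in>?Q. h (?p m) * monom_eval \<phi> m * (h (?q n) * monom_eval \<phi> n))"
    by (simp add: psubst_sum psubst_single h_mult monom_eval_add mult_ac)
  then show ?thesis
    by (simp add: psubst_eq sum_product)
qed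

lemma psubst_power: "psubst h \<phi> (p ^ n) = psubst h \<phi> p ^ n"
  by (induction n) (auto simp: psubst_1 psubst_mult)

lemma psubst_uminus: "psubst h \<phi> (- p) = - psubst h \<phi> p"
  using psubst_add[of \<phi> p "- p"] by (simp add: psubst_0 eq_neg_iff_add_eq_0 add.commute)

lemma psubst_diff: "psubst h \<phi> (p - q) = psubst h \<phi> p - psubst h \<phi> q"
  using psubst_add[of \<phi> p "- q"] by (simp add: psubst_uminus)

lemma psubst_prod: "psubst h \<phi> (prod f A) = (\<Prod>x\<in>A. psubst h \<phi> (f x))"
  by (induction A rule: infinite_finite_induct) (auto simp: psubst_1 psubst_mult)

end

interpretation peval: coeff_hom "\<lambda>c::'a::comm_ring_1. c"
  by unfold_locales auto

lemma pconst_0 [simp]: "pconst 0 = 0"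
  and pconst_1 [simp]: "pconst 1 = (1 :: ('v, 'a::comm_ring_1) mpoly)"
  by (simp_all add: pconst_def)

lemma pconst_add: "pconst (a + b) = pconst a + pconst b"
  by (simp add: pconst_def single_add)

lemma pconst_mult: "pconst (a * b) = (pconst a * pconst b :: ('v, 'a::comm_ring_1) mpoly)"
  by (simp add: pconst_def mult_single)

lemma pconst_power: "pconst (a ^ n) = (pconst a ^ n :: ('v, 'a::comm_ring_1) mpoly)"
  by (induction n) (simp_all add: pconst_mult)

lemma pconst_uminus: "pconst (- a) = (- pconst a :: ('v, 'a::comm_ring_1) mpoly)"
  by (simp add: pconst_def single_uminus)

lemma pvar_power: "pvar v ^ n = Poly_Mapping.single (Poly_Mapping.single v n) (1::'a::comm_ring_1)"
  by (induction n) (simp_all add: pvar_def mult_single flip: single_add)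

interpretation formal: coeff_hom "pconst :: 'a::comm_ring_1 \<Rightarrow> ('v, 'a) mpoly"
  by unfold_locales (auto simp: pconst_add pconst_mult)

lemma single_eq_pconst_mult_monom_eval:
  "Poly_Mapping.single m (c::'a::comm_ring_1) = pconst c * monom_eval pvar m"
proof -
  have "(\<Prod>v\<in>A. pvar v ^ Poly_Mapping.lookup m v) =
      Poly_Mapping.single (\<Sum>v\<in>A. Poly_Mapping.single v (Poly_Mapping.lookup m v)) (1::'a)" for A
    by (induction A rule: infinite_finite_induct) (auto simp: pvar_power mult_single)
  then have "monom_eval pvar m = Poly_Mapping.single m (1::'a)"
    unfolding monom_eval_def using poly_mapping_eq_sum_single[of m] by simp
  then show ?thesis
    by (simp add: pconst_def mult_single)
qed

text \<open>Writes a polynomial as an explicit sum of products of constants and variables. Both the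
  induction rule for polynomials and the spanning set of the quotient come from this form.\<close>

lemma psubst_pconst_pvar: "psubst pconst pvar p = (p :: ('v, 'a::comm_ring_1) mpoly)"
  using poly_mapping_eq_sum_single[of p]
  by (simp add: psubst_eq flip: single_eq_pconst_mult_monom_eval)


section \<open>The ring of polynomials in given variables\<close>

lemma pvars_pconst [simp]: "pvars (pconst c) = {}"
  by (simp add: pvars_def pconst_def)

lemma pvars_0 [simp]: "pvars 0 = {}" and pvars_1 [simp]: "pvars (1::('v, 'a::comm_ring_1) mpoly) = {}"
  using pvars_pconst[of 0] pvars_pconst[of "1::'a"] by (auto simp del: pvars_pconst)

lemma pvars_pvar [simp]: "pvars (pvar v :: ('v, 'a::comm_ring_1) mpoly) = {v}"
  by (simp add: pvars_def pvar_def)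

lemma pvars_add: "pvars (p + q) \<subseteq> pvars p \<union> pvars (q :: ('v, 'a::comm_ring_1) mpoly)"
  using keys_add[of p q] by (auto simp: pvars_def)

lemma pvars_uminus [simp]: "pvars (- p) = pvars (p :: ('v, 'a::comm_ring_1) mpoly)"
  by (auto simp: pvars_def in_keys_iff)

lemma pvars_diff: "pvars (p - q) \<subseteq> pvars p \<union> pvars (q :: ('v, 'a::comm_ring_1) mpoly)"
  using pvars_add[of p "- q"] by simp

lemma pvars_mult: "pvars (p * q) \<subseteq> pvars p \<union> pvars (q :: ('v, 'a::comm_ring_1) mpoly)"
proof
  fix v assume "v \<in> pvars (p * q)"
  then obtain m where "m \<in> Poly_Mapping.keys (p * q)" "v \<in> Poly_Mapping.keys m"
    by (auto simp: pvars_def)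
  then obtain a b where "a \<in> Poly_Mapping.keys p" "b \<in> Poly_Mapping.keys q" "v \<in> Poly_Mapping.keys (a + b)"
    using keys_mult[of p q] by blast
  then show "v \<in> pvars p \<union> pvars q"
    using keys_add[of a b] by (auto simp: pvars_def)
qed

lemma carrier_poly_ring [simp]: "p \<in> carrier (poly_ring V) \<longleftrightarrow> pvars p \<subseteq> V"
  and mult_poly_ring [simp]: "monoid.mult (poly_ring V) = (*)"
  and one_poly_ring [simp]: "monoid.one (poly_ring V) = 1"
  and zero_poly_ring [simp]: "ring.zero (poly_ring V) = 0"
  and add_poly_ring [simp]: "ring.add (poly_ring V) = (+)"
  by (simp_all add: poly_ring_def)

lemma pvars_add_subset: "pvars p \<subseteq> V \<Longrightarrow> pvars q \<subseteq> V \<Longrightarrow> pvars (p + q) \<subseteq> V"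
  and pvars_diff_subset: "pvars p \<subseteq> V \<Longrightarrow> pvars q \<subseteq> V \<Longrightarrow> pvars (p - q) \<subseteq> V"
  and pvars_mult_subset: "pvars p \<subseteq> V \<Longrightarrow> pvars q \<subseteq> V \<Longrightarrow> pvars (p * q) \<subseteq> V"
  for p q :: "('v, 'a::comm_ring_1) mpoly"
  using pvars_add[of p q] pvars_diff[of p q] pvars_mult[of p q] by blast+

lemma pvars_power_subset: "pvars p \<subseteq> V \<Longrightarrow> pvars ((p :: ('v, 'a::comm_ring_1) mpoly) ^ n) \<subseteq> V"
  by (induction n) (simp_all add: pvars_mult_subset)

lemma pvars_sum_subset:
  fixes f :: "'i \<Rightarrow> ('v, 'a::comm_ring_1) mpoly"
  assumes "\<And>x. x \<in> A \<Longrightarrow> pvars (f x) \<subseteq> V"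
  shows "pvars (sum f A) \<subseteq> V"
  using assms by (induction A rule: infinite_finite_induct) (simp_all add: pvars_add_subset)

lemma pvars_prod_subset:
  fixes f :: "'i \<Rightarrow> ('v, 'a::comm_ring_1) mpoly"
  assumes "\<And>x. x \<in> A \<Longrightarrow> pvars (f x) \<subseteq> V"
  shows "pvars (prod f A) \<subseteq> V"
  using assms by (induction A rule: infinite_finite_induct) (simp_all add: pvars_mult_subset)

lemmas pvars_subset_intros = pvars_add_subset pvars_diff_subset pvars_mult_subset
  pvars_power_subset pvars_sum_subset pvars_prod_subset

lemma cring_poly_ring: "cring (poly_ring V :: ('v, 'a::comm_ring_1) mpoly ring)"
proof (rule cringI)
  show "abelian_group (poly_ring V :: ('v, 'a) mpoly ring)"
  proof (rule abelian_groupI)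
    fix p :: "('v, 'a) mpoly" assume "p \<in> carrier (poly_ring V)"
    then show "\<exists>q\<in>carrier (poly_ring V). q \<oplus>\<^bsub>poly_ring V\<^esub> p = \<zero>\<^bsub>poly_ring V\<^esub>"
      by (intro bexI[of _ "- p"]) auto
  qed (auto simp: add_ac dest: subsetD[OF pvars_add])
  show "comm_monoid (poly_ring V :: ('v, 'a) mpoly ring)"
    by (rule comm_monoidI) (auto simp: mult_ac dest: subsetD[OF pvars_mult])
qed (auto simp: algebra_simps)

lemma ring_poly_ring: "ring (poly_ring V :: ('v, 'a::comm_ring_1) mpoly ring)"
  using cring_poly_ring by (rule cring.axioms)

lemma nat_pow_poly_ring [simp]: "p [^]\<^bsub>poly_ring V\<^esub> (n::nat) = (p :: ('v, 'a::comm_ring_1) mpoly) ^ n"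
  by (induction n) (simp_all add: nat_pow_def mult_ac)

text \<open>By \<open>psubst_pconst_pvar\<close>, every polynomial arises from constants and
  variables of \<open>V\<close> by sums and products.\<close>

lemma poly_ring_induct [consumes 1, case_names pconst pvar add mult]:
  fixes p :: "('v, 'a::comm_ring_1) mpoly"
  assumes "pvars p \<subseteq> V" "\<And>c. P (pconst c)" "\<And>v. v \<in> V \<Longrightarrow> P (pvar v)"
    and add: "\<And>p q. P p \<Longrightarrow> P q \<Longrightarrow> P (p + q)" and mult: "\<And>p q. P p \<Longrightarrow> P q \<Longrightarrow> P (p * q)"
  shows "P p"
proof -
  have 0: "P 0" and 1: "P 1"
    using assms(2)[of 0] assms(2)[of 1] by auto
  have sum: "P (sum f A)" if "\<And>x. x \<in> A \<Longrightarrow> P (f x)" for f :: "('v \<Rightarrow>\<^sub>0 nat) \<Rightarrow> ('v, 'a) mpoly" and A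
    using that by (induction A rule: infinite_finite_induct) (auto intro: 0 add)
  have prod: "P (prod f A)" if "\<And>x. x \<in> A \<Longrightarrow> P (f x)" for f :: "'v \<Rightarrow> ('v, 'a) mpoly" and A
    using that by (induction A rule: infinite_finite_induct) (auto intro: 1 mult)
  have power: "P (p ^ n)" if "P p" for p n
    using that by (induction n) (auto intro: 1 mult)
  have "P (psubst pconst pvar p)"
    unfolding psubst_eq monom_eval_def
    by (intro sum mult prod power assms(2,3)) (use assms(1) in \<open>auto simp: pvars_def\<close>)
  then show ?thesis
    by (simp add: psubst_pconst_pvar)
qed

text \<open>This is the kernel of evaluation at \<open>s\<close>. Being an ideal, it contains a
  generated ideal as soon as it contains the generators, so vanishing need only be tested on
  these.\<close>

lemma ideal_vanishing:
  fixes V :: "'v set" and s :: "'v \<Rightarrow> 'a::comm_ring_1"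
  shows "ideal {p. pvars p \<subseteq> V \<and> peval s p = 0} (poly_ring V)"
proof (rule idealI[OF ring_poly_ring])
  interpret R: ring "poly_ring V :: ('v, 'a) mpoly ring" by (rule ring_poly_ring)
  show "subgroup {p. pvars p \<subseteq> V \<and> peval s p = 0} (add_monoid (poly_ring V))"
  proof (rule R.add.subgroupI)
    fix p assume p: "p \<in> {p. pvars p \<subseteq> V \<and> peval s p = 0}"
    then have "\<ominus>\<^bsub>poly_ring V\<^esub> p = - p"
      by (intro R.minus_equality) auto
    then show "\<ominus>\<^bsub>poly_ring V\<^esub> p \<in> {p. pvars p \<subseteq> V \<and> peval s p = 0}"
      using p by (simp add: peval.psubst_uminus)
  qed (auto simp: peval.psubst_add peval.psubst_0 dest: subsetD[OF pvars_add] intro!: exI[of _ 0])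
qed (auto simp: peval.psubst_mult dest: subsetD[OF pvars_mult])

lemma vanishes_on_genideal_iff:
  fixes S :: "('v, 'a::comm_ring_1) mpoly set"
  assumes "\<And>p. p \<in> S \<Longrightarrow> pvars p \<subseteq> V"
  shows "(\<forall>p\<in>Idl\<^bsub>poly_ring V\<^esub> S. peval s p = 0) \<longleftrightarrow> (\<forall>p\<in>S. peval s p = 0)"
proof -
  interpret R: ring "poly_ring V :: ('v, 'a) mpoly ring" by (rule ring_poly_ring)
  have S: "S \<subseteq> carrier (poly_ring V)" using assms by auto
  show ?thesis
    using R.genideal_self[OF S] R.genideal_minimal[OF ideal_vanishing[of V s], of S] assms by blast
qed

lemma subset_set_add_ideals:
  fixes A B :: "('v, 'a::comm_ring_1) mpoly set"
  assumes "ideal A (poly_ring V)" "ideal B (poly_ring V)"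
  shows "A \<subseteq> A <+>\<^bsub>poly_ring V\<^esub> B" "B \<subseteq> A <+>\<^bsub>poly_ring V\<^esub> B"
proof -
  have "0 \<in> A" "0 \<in> B"
    using assms by (metis ideal_def additive_subgroup.zero_closed zero_poly_ring)+
  then show "A \<subseteq> A <+>\<^bsub>poly_ring V\<^esub> B" "B \<subseteq> A <+>\<^bsub>poly_ring V\<^esub> B"
    by (force simp: set_add_def')+
qed

lemma vanishes_on_set_add_iff:
  fixes A B :: "('v, 'a::comm_ring_1) mpoly set"
  assumes "ideal A (poly_ring V)" "ideal B (poly_ring V)"
  shows "(\<forall>p\<in>A <+>\<^bsub>poly_ring V\<^esub> B. peval s p = 0) \<longleftrightarrow>
    (\<forall>p\<in>A. peval s p = 0) \<and> (\<forall>p\<in>B. peval s p = 0)"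
  using subset_set_add_ideals[OF assms] by (auto simp: set_add_def' peval.psubst_add)


section \<open>Ideals containing the field equations\<close>

lemma CHAR_mpoly: "CHAR(('v, 'a::comm_ring_1) mpoly) = CHAR('a)"
proof (rule CHAR_eqI)
  have *: "of_nat n = (pconst (of_nat n) :: ('v, 'a) mpoly)" for n
    by (simp add: pconst_def)
  show "of_nat CHAR('a) = (0 :: ('v, 'a) mpoly)"
    by (simp add: *)
  show "CHAR('a) dvd n" if "of_nat n = (0 :: ('v, 'a) mpoly)" for n
    \<comment> \<open>Reading off the coefficient at the monomial \<open>0\<close> transfers the
      equation to the coefficient ring.\<close>
    using that unfolding * by (metis pconst_def of_nat_eq_0_iff_char_dvd lookup_single_eq lookup_zero)
qed

lemma prime_CHAR_finite_field: "prime CHAR('a::{field,finite})"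
  by (rule prime_CHAR_semidom[OF finite_imp_CHAR_pos]) simp

text \<open>Multiplication by \<open>a\<close> permutes the nonzero elements and so preserves their
  product, which is nonzero and can be cancelled.\<close>

lemma power_CARD_minus_1_eq_1:
  fixes a :: "'a::{field,finite}"
  assumes "a \<noteq> 0"
  shows "a ^ (CARD('a) - 1) = 1"
proof -
  have "(\<Prod>y\<in>UNIV - {0}. a * y) = \<Prod>(UNIV - {0})"
    by (rule prod.reindex_bij_witness[of _ "\<lambda>y. y / a" "\<lambda>y. a * y"]) (use assms in auto)
  then have "a ^ (CARD('a) - 1) * \<Prod>(UNIV - {0 :: 'a}) = 1 * \<Prod>(UNIV - {0})"
    by (simp add: prod.distrib card_Diff_singleton)
  then show ?thesis
    by (subst (asm) mult_cancel_right) simp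
qed

lemma CARD_field_ge_2: "CARD('a::{field,finite}) \<ge> 2"
  using card_mono[of "UNIV :: 'a set" "{0, 1}"] by simp

lemma power_CARD_eq_self: "(a::'a::{field,finite}) ^ CARD('a) = a"
proof (cases "a = 0")
  case False
  have "a ^ CARD('a) = a * a ^ (CARD('a) - 1)"
    using CARD_field_ge_2[where ?'a = 'a] by (simp flip: power_Suc)
  then show ?thesis using power_CARD_minus_1_eq_1[OF False] by simp
qed (use CARD_field_ge_2[where ?'a = 'a] in auto)

text \<open>Collects what radicality and zero-dimensionality rest on; the final proof instantiates
  it for \<open>SJ\<close> and for \<open>SJ_deg d\<close>.\<close>

locale field_equations_ideal = ideal I "poly_ring V" 
  for V :: "'v set" and I :: "('v, 'a::{field,finite}) mpoly set" +
  assumes finite_V: "finite V"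
    and field_eq: "\<And>v. v \<in> V \<Longrightarrow> pvar v ^ CARD('a) - pvar v \<in> I"
begin

section \<open>Congruence modulo the ideal and reduction of exponents\<close>

lemma in_I_pvars: "p \<in> I \<Longrightarrow> pvars p \<subseteq> V"
  using Icarr by simp

lemma I_0: "0 \<in> I"
  using additive_subgroup.zero_closed[OF additive_subgroup_axioms] by simp

lemma I_add: "p \<in> I \<Longrightarrow> q \<in> I \<Longrightarrow> p + q \<in> I"
  using additive_subgroup.a_closed[OF additive_subgroup_axioms] by simp

lemma I_mult: "p \<in> I \<Longrightarrow> pvars q \<subseteq> V \<Longrightarrow> p * q \<in> I"
  using I_r_closed by simp

lemma I_uminus: "p \<in> I \<Longrightarrow> - p \<in> I"
  using I_mult[of p "pconst (- 1)"] by (simp add: pconst_uminus)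

text \<open>Both sides are required to lie in the polynomial ring, so that transitivity and
  compatibility with products need no side conditions.\<close>

definition cong_I (infix "\<approx>" 50) where
  "p \<approx> q \<longleftrightarrow> pvars p \<subseteq> V \<and> pvars q \<subseteq> V \<and> p - q \<in> I"

lemma cong_refl: "pvars p \<subseteq> V \<Longrightarrow> p \<approx> p"
  by (simp add: cong_I_def I_0)

lemma cong_sym: "p \<approx> q \<Longrightarrow> q \<approx> p"
  using I_uminus[of "p - q"] by (simp add: cong_I_def)

lemma cong_trans [trans]: "p \<approx> q \<Longrightarrow> q \<approx> r \<Longrightarrow> p \<approx> r"
  using I_add[of "p - q" "q - r"] by (simp add: cong_I_def)

lemma cong_add: "p \<approx> p' \<Longrightarrow> q \<approx> q' \<Longrightarrow> p + q \<approx> p' + q'"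
  using I_add[of "p - p'" "q - q'"]
  by (auto simp: cong_I_def algebra_simps dest: subsetD[OF pvars_add])

lemma cong_mult:
  assumes "p \<approx> p'" "q \<approx> q'"
  shows "p * q \<approx> p' * q'"
proof -
  have "(p - p') * q + (q - q') * p' \<in> I"
    using assms by (intro I_add I_mult) (auto simp: cong_I_def)
  then show ?thesis
    using assms by (auto simp: cong_I_def algebra_simps dest: subsetD[OF pvars_mult])
qed

lemma cong_prod: "(\<And>x. x \<in> A \<Longrightarrow> f x \<approx> g x) \<Longrightarrow> prod f A \<approx> prod g A"
  by (induction A rule: infinite_finite_induct) (auto intro: cong_mult cong_refl)

lemma pvar_power_CARD_cong: "v \<in> V \<Longrightarrow> pvar v ^ CARD('a) \<approx> pvar v"
  by (auto simp: cong_I_def field_eq intro!: pvars_power_subset)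

text \<open>Each replacement of \<open>x^q\<close> by \<open>x\<close> lowers the exponent by
  \<open>q - 1\<close>.\<close>

lemma pvar_power_cong:
  assumes "v \<in> V"
  shows "pvar v ^ (k * (CARD('a) - 1) + 1) \<approx> pvar v"
proof (induction k)
  case (Suc k)
  have "Suc k * (CARD('a) - 1) + 1 = k * (CARD('a) - 1) + CARD('a)"
    using CARD_field_ge_2[where ?'a = 'a] by simp
  then have "(pvar v :: ('v, 'a) mpoly) ^ (Suc k * (CARD('a) - 1) + 1) =
      pvar v ^ (k * (CARD('a) - 1)) * pvar v ^ CARD('a)"
    by (simp only: power_add)
  also have "\<dots> \<approx> pvar v ^ (k * (CARD('a) - 1)) * pvar v"
    using assms by (intro cong_mult pvar_power_CARD_cong cong_refl pvars_power_subset) auto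
  also have "\<dots> = pvar v ^ (k * (CARD('a) - 1) + 1)"
    by (simp add: mult.commute)
  also have "\<dots> \<approx> pvar v"
    by (rule Suc.IH)
  finally show ?case .
qed (use assms in \<open>auto intro: cong_refl\<close>)

text \<open>The relation \<open>x^q = x\<close> identifies positive exponents that agree modulo
  \<open>q - 1\<close>, but \<open>x^(q-1)\<close> need not be congruent to \<open>1\<close>. Hence
  \<open>e - 1\<close> is reduced and \<open>1\<close> is added back, which gives an exponent
  between \<open>1\<close> and \<open>q - 1\<close>; the exponent \<open>0\<close> is kept.\<close>

lemma pvar_power_reduce:
  assumes "v \<in> V"
  shows "\<exists>k<CARD('a). pvar v ^ e \<approx> pvar v ^ k"
proof (cases "e = 0")
  case False
  let ?r = "(e - 1) mod (CARD('a) - 1)" and ?k = "(e - 1) div (CARD('a) - 1)"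
  have "?k * (CARD('a) - 1) + ?r = e - 1"
    by (rule div_mult_mod_eq)
  then have "e = ?k * (CARD('a) - 1) + 1 + ?r"
    using False by linarith
  then have "(pvar v :: ('v, 'a) mpoly) ^ e = pvar v ^ (?k * (CARD('a) - 1) + 1) * pvar v ^ ?r"
    by (metis power_add)
  also have "\<dots> \<approx> pvar v * pvar v ^ ?r"
    using assms by (intro cong_mult pvar_power_cong cong_refl pvars_power_subset) auto
  also have "\<dots> = pvar v ^ Suc ?r"
    by simp
  finally have "pvar v ^ e \<approx> pvar v ^ Suc ?r" .
  moreover have "Suc ?r < CARD('a)"
    using CARD_field_ge_2[where ?'a = 'a] mod_less_divisor[of "CARD('a) - 1" "e - 1"] by linarith
  ultimately show ?thesis by blast
qed (use CARD_field_ge_2[where ?'a = 'a] in \<open>auto intro!: exI[of _ 0] cong_refl\<close>)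

text \<open>
  The characteristic \<open>p\<close> divides \<open>q\<close> and is therefore coprime to \<open>q - 1\<close>, so some power \<open>N\<close> of \<open>p\<close>
  is congruent to \<open>1\<close> modulo \<open>q - 1\<close>. Raising to the power \<open>N\<close> is additive and fixes the constants
  and, modulo \<open>I\<close>, the variables.
\<close>

lemma frobenius_cong: "\<exists>N\<ge>2. \<forall>p. pvars p \<subseteq> V \<longrightarrow> p ^ N \<approx> p"
proof -
  define q where "q = CARD('a)"
  have q: "q \<ge> 2"
    using CARD_field_ge_2 by (simp add: q_def)
  \<comment> \<open>With this exponent Euler's theorem applies to the modulus \<open>q - 1\<close>;
    \<open>k > 0\<close> ensures that the resulting power of the characteristic is at least
    \<open>2\<close>.\<close>
  define k where "k = totient (q - 1)"
  have "k > 0"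
    using q by (simp add: k_def)
  have prime: "prime CHAR('a)"
    by (rule prime_CHAR_finite_field)
  have "coprime CHAR('a) (q - 1)"
  proof -
    have "coprime q (q - 1)"
      using q coprime_Suc_left_nat[of "q - 1"] by simp
    then show ?thesis
      using CHAR_dvd_CARD[where ?'a = 'a] coprime_divisors[OF _ dvd_refl] by (metis q_def)
  qed
  then have "[CHAR('a) ^ k = 1] (mod (q - 1))"
    unfolding k_def by (rule euler_theorem)
  moreover have N: "CHAR('a) ^ k \<ge> 2"
    using prime_ge_2_nat[OF prime] \<open>k > 0\<close> self_le_power[of "CHAR('a)" k] by simp
  ultimately have "q - 1 dvd CHAR('a) ^ k - 1"
    by (metis cong_altdef_nat cong_sym one_le_numeral order_trans Cong.cong_sym)
  then obtain l where "CHAR('a) ^ k - 1 = l * (q - 1)"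
    by (metis dvd_div_mult_self)
  then have l: "CHAR('a) ^ k = l * (q - 1) + 1"
    using N by simp
  \<comment> \<open>For nonzero \<open>c\<close> the left side is
    \<open>(c ^ (q - 1)) ^ l * c\<close>, and for \<open>c = 0\<close> it is a positive power of
    \<open>0\<close>.\<close>
  have const: "c ^ (CHAR('a) ^ k) = c" for c :: 'a
    using power_CARD_minus_1_eq_1[of c] unfolding l q_def
    by (cases "c = 0") (simp_all add: power_add power_mult mult.commute[of l])
  have "p ^ (CHAR('a) ^ k) \<approx> p" if "pvars p \<subseteq> V" for p
    using that
  proof (induction p rule: poly_ring_induct)
    case (pconst c)
    then show ?case by (simp add: const cong_refl flip: pconst_power)
  next
    case (pvar v)
    then show ?case using pvar_power_cong[of v l] by (simp add: l q_def)
  next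
    case (add p r)
    then show ?case
      \<comment> \<open>The Frobenius map is additive in the polynomial ring because its
        characteristic is that of the coefficient field.\<close>
      using prime by (subst freshmans_dream'[of _ k]) (auto simp: CHAR_mpoly intro: cong_add)
  next
    case (mult p r)
    then show ?case by (simp add: power_mult_distrib cong_mult)
  qed
  then show ?thesis
    using N by blast
qed

lemma mem_if_power_mem:
  assumes "pvars p \<subseteq> V" "p ^ n \<in> I"
  shows "p \<in> I"
proof -
  obtain N :: nat where N: "N \<ge> 2" "\<And>p. pvars p \<subseteq> V \<Longrightarrow> p ^ N \<approx> p"
    using frobenius_cong by blast
  have "p ^ (N ^ j) \<approx> p" for j
  proof (induction j)
    case (Suc j)
    have "p ^ (N ^ Suc j) = (p ^ N ^ j) ^ N"
      by (simp add: mult.commute flip: power_mult)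
    also have "\<dots> \<approx> p ^ N ^ j"
      by (rule N(2)) (rule pvars_power_subset[OF assms(1)])
    also note Suc.IH
    finally show ?case .
  qed (simp add: cong_refl assms)
  then have "p ^ (N ^ n) \<approx> p" .
  \<comment> \<open>This makes \<open>p ^ n\<close> a factor of \<open>p ^ (N ^ n)\<close>, which
    therefore lies in \<open>I\<close>.\<close>
  moreover have "n \<le> N ^ n"
  proof -
    have "n < 2 ^ n" by (rule less_exp)
    also have "\<dots> \<le> N ^ n" using N(1) by (rule power_mono) simp
    finally show ?thesis by simp
  qed
  then have "p ^ (N ^ n) = p ^ n * p ^ (N ^ n - n)"
    by (simp flip: power_add)
  then have "p ^ (N ^ n) \<in> I"
    using assms by (simp add: I_mult pvars_power_subset)
  ultimately show ?thesis
    using I_add[of "p ^ (N ^ n)" "- (p ^ (N ^ n) - p)"] I_uminus[of "p ^ (N ^ n) - p"] by (simp add: cong_I_def)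
qed

lemma radical_ideal: "radical_ideal (poly_ring V) I"
  unfolding radical_ideal_def
  by (auto simp: ideal_axioms is_ideal intro: mem_if_power_mem dest: in_I_pvars intro!: exI[of _ 1])


section \<open>Residue classes and the dimension of the quotient\<close>

lemma coset_eq_iff:
  assumes "pvars p \<subseteq> V" "pvars q \<subseteq> V"
  shows "I +>\<^bsub>poly_ring V\<^esub> p = I +>\<^bsub>poly_ring V\<^esub> q \<longleftrightarrow> p \<approx> q"
proof -
  have "\<ominus>\<^bsub>poly_ring V\<^esub> q = - q"
    using assms by (intro minus_equality) auto
  then show ?thesis
    using quotient_eq_iff_same_a_r_cos[OF is_ideal, of p q] assms
    by (simp add: a_minus_def cong_I_def)
qed

lemma zero_dimensional_ideal: "zero_dimensional_ideal V I"
proof -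
  let ?h = "\<lambda>p. I +>\<^bsub>poly_ring V\<^esub> p" and ?Q = "poly_ring V Quot I"
  interpret h: ring_hom_ring "poly_ring V" ?Q ?h
    by (rule rcos_ring_hom_ring)
  have carrier_Q: "carrier ?Q = ?h ` {p. pvars p \<subseteq> V}"
    by (auto simp: FactRing_def A_RCOSETS_def')
  have zero_Q: "\<zero>\<^bsub>?Q\<^esub> = ?h 0" and one_Q: "\<one>\<^bsub>?Q\<^esub> = ?h 1"
    using h.hom_zero h.hom_one by simp_all
  have "h.S.finite_dimension (range (\<lambda>c. ?h (pconst c))) (carrier ?Q)"
  proof (cases "1 \<in> I")
    case True
    then have "p \<approx> 0" if "pvars p \<subseteq> V" for p
      using that I_mult[of 1 p] by (simp add: cong_I_def)
    then have "?h p = ?h 0" if "pvars p \<subseteq> V" for p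
      using that by (subst coset_eq_iff) auto
    then have "carrier ?Q = {\<zero>\<^bsub>?Q\<^esub>}"
      unfolding carrier_Q zero_Q
    proof (intro equalityI subsetI)
      show "x \<in> ?h ` {p. pvars p \<subseteq> V}" if "x \<in> {?h 0}" for x
        using that by (intro image_eqI[of _ _ 0]) auto
    qed blast
    then show ?thesis
      by (simp only: h.S.finite_dimensionI[OF h.S.dimension.intros(1)])
  next
    case False
    define K where "K = range (\<lambda>c. ?h (pconst c))"
    have "subfield (range pconst) (poly_ring V :: ('v, 'a) mpoly ring)"
    proof (rule subfieldI)
      have m: "\<ominus>\<^bsub>poly_ring V\<^esub> pconst c = pconst (- c)" for c :: 'a
        by (rule minus_equality) (auto simp: pconst_uminus)
      have 1: "(1 :: ('v, 'a) mpoly) \<in> range pconst"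
        using pconst_1 by (metis rangeI)
      have "subring (range pconst) (poly_ring V :: ('v, 'a) mpoly ring)"
        by (rule subringI) (auto simp: m 1 simp flip: pconst_add pconst_mult)
      then show "subcring (range pconst) (poly_ring V :: ('v, 'a) mpoly ring)"
        by (rule subcringI) (simp add: mult.commute)
      have inverse: "pconst c * pconst (inverse c) = (1 :: ('v, 'a) mpoly)" if "c \<noteq> 0" for c :: 'a
        using that by (simp flip: pconst_mult)
      show "Units ((poly_ring V :: ('v, 'a) mpoly ring)\<lparr>carrier := range pconst\<rparr>) =
          range pconst - {\<zero>\<^bsub>poly_ring V\<^esub>}"
      proof (intro equalityI subsetI)
        fix p :: "('v, 'a) mpoly" assume "p \<in> range pconst - {\<zero>\<^bsub>poly_ring V\<^esub>}"
        then obtain c where "p = pconst c" "p \<noteq> 0" by auto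
        moreover from this have "c \<noteq> 0" by auto
        ultimately show "p \<in> Units (poly_ring V\<lparr>carrier := range pconst\<rparr>)"
          using inverse by (auto simp: Units_def mult.commute intro!: exI[of _ "inverse c"])
      qed (auto simp: Units_def)
    qed
    \<comment> \<open>Nontriviality of the quotient is what makes the homomorphism \<open>?h\<close>
      carry the field of constants to a subfield.\<close>
    moreover have "\<one>\<^bsub>?Q\<^esub> \<noteq> \<zero>\<^bsub>?Q\<^esub>"
      unfolding one_Q zero_Q using False coset_eq_iff[of 1 0] by (simp add: cong_I_def)
    ultimately have K: "subfield K ?Q"
      unfolding K_def image_image[symmetric] by (rule h.img_is_subfield(2))
    \<comment> \<open>The classes of the monomials with all exponents below \<open>q\<close>: there
      are finitely many, and they span by \<open>pvar_power_reduce\<close>.\<close>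
    define M where "M = (\<lambda>g. ?h (\<Prod>v\<in>V. pvar v ^ g v)) ` (V \<rightarrow>\<^sub>E {..<CARD('a)})"
    have "finite M"
      unfolding M_def using finite_V by (intro finite_imageI finite_PiE) auto
    then obtain Us where Us: "set Us = M"
      using finite_list by blast
    have Us_carrier: "set Us \<subseteq> carrier ?Q"
      unfolding Us M_def carrier_Q by (auto intro!: imageI pvars_subset_intros)
    note Span = h.S.Span_subgroup_props[OF K Us_carrier] h.S.Span_smult_closed[OF K Us_carrier]
    have monomial: "?h (pconst c * monom_eval pvar m) \<in> h.S.Span K Us"
      if m: "Poly_Mapping.keys m \<subseteq> V" for c m
    proof -
      have "\<forall>v\<in>V. \<exists>k<CARD('a). pvar v ^ Poly_Mapping.lookup m v \<approx> pvar v ^ k"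
        using pvar_power_reduce by blast
      then obtain r where r: "\<And>v. v \<in> V \<Longrightarrow> r v < CARD('a)"
          "\<And>v. v \<in> V \<Longrightarrow> pvar v ^ Poly_Mapping.lookup m v \<approx> pvar v ^ r v"
        using bchoice[of V "\<lambda>v k. k < CARD('a) \<and> pvar v ^ Poly_Mapping.lookup m v \<approx> pvar v ^ k"]
        by blast
      have "monom_eval pvar m = (\<Prod>v\<in>V. pvar v ^ Poly_Mapping.lookup m v :: ('v, 'a) mpoly)"
        using finite_V m by (rule monom_eval_superset)
      also have "\<dots> \<approx> (\<Prod>v\<in>V. pvar v ^ r v)"
        using r(2) by (rule cong_prod)
      \<comment> \<open>Restricting \<open>r\<close> places it in the extensional function space
        that indexes \<open>M\<close>.\<close>
      also have "\<dots> = (\<Prod>v\<in>V. pvar v ^ restrict r V v)"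
        by simp
      finally have *: "monom_eval pvar m \<approx> (\<Prod>v\<in>V. pvar v ^ restrict r V v)" .
      then have "?h (monom_eval pvar m) = ?h (\<Prod>v\<in>V. pvar v ^ restrict r V v)"
        using coset_eq_iff by (simp add: cong_I_def)
      also have "\<dots> \<in> set Us"
        unfolding Us M_def using r(1) by (intro imageI) auto
      finally have "?h (monom_eval pvar m) \<in> h.S.Span K Us"
        using h.S.Span_base_incl[OF K Us_carrier] by blast
      then have "?h (pconst c) \<otimes>\<^bsub>?Q\<^esub> ?h (monom_eval pvar m) \<in> h.S.Span K Us"
        by (rule Span(5)[rotated]) (simp add: K_def)
      then show ?thesis
        using h.hom_mult[of "pconst c" "monom_eval pvar m"] * by (simp add: cong_I_def)
    qed
    have sum: "?h (sum f A) \<in> h.S.Span K Us"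
      if "\<And>m. m \<in> A \<Longrightarrow> pvars (f m) \<subseteq> V \<and> ?h (f m) \<in> h.S.Span K Us"
      for f :: "('v \<Rightarrow>\<^sub>0 nat) \<Rightarrow> ('v, 'a) mpoly" and A
      using that
    proof (induction A rule: infinite_finite_induct)
      case (insert x A)
      then have "?h (f x + sum f A) = ?h (f x) \<oplus>\<^bsub>?Q\<^esub> ?h (sum f A)"
        using h.hom_add[of "f x" "sum f A"] by (simp add: pvars_sum_subset)
      moreover have "?h (f x) \<oplus>\<^bsub>?Q\<^esub> ?h (sum f A) \<in> h.S.Span K Us"
        using insert by (intro Span(3)) auto
      ultimately show ?case
        using insert.hyps by simp
    qed (use Span(2) zero_Q in auto)
    have "?h p \<in> h.S.Span K Us" if p: "pvars p \<subseteq> V" for p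
    proof -
      have "?h (psubst pconst pvar p) \<in> h.S.Span K Us"
        unfolding psubst_eq
      proof (rule sum, rule conjI)
        fix m assume "m \<in> Poly_Mapping.keys p"
        then have m: "Poly_Mapping.keys m \<subseteq> V"
          using p by (auto simp: pvars_def)
        then show "pvars (pconst (Poly_Mapping.lookup p m) * monom_eval pvar m :: ('v, 'a) mpoly) \<subseteq> V"
          unfolding monom_eval_def by (intro pvars_subset_intros) auto
        show "?h (pconst (Poly_Mapping.lookup p m) * monom_eval pvar m) \<in> h.S.Span K Us"
          by (rule monomial[OF m])
      qed
      then show ?thesis
        by (simp add: psubst_pconst_pvar)
    qed
    then have "carrier ?Q = h.S.Span K Us"
      using Span(1) unfolding carrier_Q by blast
    then show ?thesis
      using h.S.Span_finite_dimension[OF K Us_carrier] by (simp add: K_def)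
  qed
  then show ?thesis
    by (simp add: zero_dimensional_ideal_def is_ideal)
qed

end


section \<open>Polynomials in two variables\<close>

lemma UNIV_xy: "(UNIV :: xy set) = {X, Y}"
proof (intro equalityI subsetI)
  show "v \<in> {X, Y}" for v :: xy by (cases v) auto
qed simp

text \<open>Exponent pairs serve as coordinates on the monomials in two variables, so that
  coefficients are indexed in the same way as the variables \<open>x_ij\<close>.\<close>

definition mon :: "nat \<Rightarrow> nat \<Rightarrow> xy \<Rightarrow>\<^sub>0 nat" where
  "mon i j = Poly_Mapping.single X i + Poly_Mapping.single Y j"

lemma lookup_mon [simp]:
  "Poly_Mapping.lookup (mon i j) X = i" "Poly_Mapping.lookup (mon i j) Y = j"
  by (simp_all add: mon_def lookup_add lookup_single)

lemma mon_lookup [simp]: "mon (Poly_Mapping.lookup m X) (Poly_Mapping.lookup m Y) = m"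
proof (rule poly_mapping_eqI)
  show "Poly_Mapping.lookup (mon (Poly_Mapping.lookup m X) (Poly_Mapping.lookup m Y)) v =
    Poly_Mapping.lookup m v" for v by (cases v) auto
qed

lemma mon_eq_iff [simp]: "mon i j = mon k l \<longleftrightarrow> i = k \<and> j = l"
  by (metis lookup_mon)

lemma all_mon: "(\<forall>m. P m) \<longleftrightarrow> (\<forall>i j. P (mon i j))"
  by (metis mon_lookup)

lemma ex_mon: "(\<exists>m. P m) \<longleftrightarrow> (\<exists>i j. P (mon i j))"
  by (metis mon_lookup)

lemma monom_eval_xy:
  "monom_eval (case_xy u w) m = u ^ Poly_Mapping.lookup m X * w ^ Poly_Mapping.lookup m Y"
proof -
  have "finite (UNIV :: xy set)" by (simp add: UNIV_xy)
  from monom_eval_superset[OF this subset_UNIV, of "case_xy u w" m] show ?thesis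
    by (simp add: UNIV_xy)
qed

lemma sum_lookup_xy:
  "(\<Sum>v\<in>Poly_Mapping.keys m. Poly_Mapping.lookup m v) = Poly_Mapping.lookup m X + Poly_Mapping.lookup m Y"
proof -
  have "(\<Sum>v\<in>Poly_Mapping.keys m. Poly_Mapping.lookup m v) = (\<Sum>v\<in>UNIV. Poly_Mapping.lookup m v)"
  proof (rule sum.mono_neutral_left)
    show "finite (UNIV :: xy set)" by (simp add: UNIV_xy)
  qed (auto simp: in_keys_iff)
  then show ?thesis by (simp add: UNIV_xy)
qed

lemma degree_in_less_iff:
  assumes "n > 0"
  shows "degree_in v p < n \<longleftrightarrow> (\<forall>m. Poly_Mapping.lookup p m \<noteq> 0 \<longrightarrow> Poly_Mapping.lookup m v < n)"
  using assms by (auto simp: degree_in_def in_keys_iff)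

text \<open>For nonzero \<open>f\<close> the conventional \<open>0\<close> does not affect the
  maximum. The two conjuncts match the two families of generators that \<open>J_deg\<close> adds to
  \<open>J\<close>.\<close>

lemma total_degree_eq_iff:
  fixes f :: "(xy, 'a::zero) mpoly"
  assumes "f \<noteq> 0"
  shows "total_degree f = d \<longleftrightarrow>
    (\<forall>i j. i + j > d \<longrightarrow> Poly_Mapping.lookup f (mon i j) = 0) \<and>
    (\<exists>i j. i + j = d \<and> Poly_Mapping.lookup f (mon i j) \<noteq> 0)"
proof -
  let ?D = "(\<lambda>m. Poly_Mapping.lookup m X + Poly_Mapping.lookup m Y) ` Poly_Mapping.keys f"
  obtain m0 where "Poly_Mapping.lookup f m0 \<noteq> 0"
    using assms by (metis poly_mapping_eqI lookup_zero)
  then have "?D \<noteq> {}" by (auto simp: in_keys_iff)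
  then have "total_degree f = Max ?D"
    by (simp add: total_degree_def sum_lookup_xy)
  also have "\<dots> = d \<longleftrightarrow> d \<in> ?D \<and> (\<forall>e\<in>?D. e \<le> d)"
    using \<open>?D \<noteq> {}\<close> by (intro Max_eq_iff) auto
  also have "d \<in> ?D \<longleftrightarrow> (\<exists>i j. i + j = d \<and> Poly_Mapping.lookup f (mon i j) \<noteq> 0)"
    unfolding image_iff Bex_def in_keys_iff ex_mon lookup_mon by auto
  also have "(\<forall>e\<in>?D. e \<le> d) \<longleftrightarrow>
      (\<forall>m. Poly_Mapping.lookup f m \<noteq> 0 \<longrightarrow> Poly_Mapping.lookup m X + Poly_Mapping.lookup m Y \<le> d)"
    by (auto simp: in_keys_iff)
  also have "\<dots> \<longleftrightarrow> (\<forall>i j. i + j > d \<longrightarrow> Poly_Mapping.lookup f (mon i j) = 0)"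
    unfolding all_mon lookup_mon by (auto simp: not_le[symmetric])
  finally show ?thesis by blast
qed

lemma poly_eqI_mon:
  fixes f g :: "(xy, 'a::zero) mpoly"
  assumes "\<And>i j. Poly_Mapping.lookup f (mon i j) = Poly_Mapping.lookup g (mon i j)"
  shows "f = g"
proof (rule poly_mapping_eqI)
  show "Poly_Mapping.lookup f m = Poly_Mapping.lookup g m" for m
    using assms[of "Poly_Mapping.lookup m X" "Poly_Mapping.lookup m Y"] by simp
qed

text \<open>Padding the support to a square of exponents gives a double sum that can be sorted by
  powers of either variable.\<close>

lemma (in coeff_hom) bisubst_eq:
  assumes "\<And>i j. Poly_Mapping.lookup f (mon i j) \<noteq> 0 \<Longrightarrow> i < n \<and> j < n"
  shows "bisubst h u w f = (\<Sum>i<n. \<Sum>j<n. h (Poly_Mapping.lookup f (mon i j)) * u ^ i * w ^ j)"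
proof -
  have "bisubst h u w f = (\<Sum>m\<in>case_prod mon ` ({..<n} \<times> {..<n}).
      h (Poly_Mapping.lookup f m) * monom_eval (case_xy u w) m)"
    unfolding psubst_eq
  proof (rule sum.mono_neutral_left)
    show "Poly_Mapping.keys f \<subseteq> case_prod mon ` ({..<n} \<times> {..<n})"
    proof
      fix m assume "m \<in> Poly_Mapping.keys f"
      then have "Poly_Mapping.lookup m X < n \<and> Poly_Mapping.lookup m Y < n"
        by (intro assms) (simp add: in_keys_iff)
      then show "m \<in> case_prod mon ` ({..<n} \<times> {..<n})"
        by (intro image_eqI[of _ _ "(Poly_Mapping.lookup m X, Poly_Mapping.lookup m Y)"]) auto
    qed
  qed (auto simp: in_keys_iff h_0)
  also have "\<dots> = (\<Sum>(i, j)\<in>{..<n} \<times> {..<n}. h (Poly_Mapping.lookup f (mon i j)) * u ^ i * w ^ j)"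
    by (subst sum.reindex) (auto simp: inj_on_def monom_eval_xy mult.assoc intro!: sum.cong)
  finally show ?thesis
    by (simp add: sum.cartesian_product)
qed

text \<open>Exchanging the variables transposes the array of coefficients.\<close>

lemma symmetric_poly_iff:
  fixes f :: "(xy, 'a::comm_ring_1) mpoly"
  shows "symmetric_poly f \<longleftrightarrow>
    (\<forall>i j. Poly_Mapping.lookup f (mon i j) = Poly_Mapping.lookup f (mon j i))"
proof -
  have "bisubst pconst (pvar X) (pvar Y) f = f"
  proof -
    have "case_xy (pvar X) (pvar Y) = (pvar :: xy \<Rightarrow> (xy, 'a) mpoly)"
      by (rule ext) (simp split: xy.split)
    then show ?thesis by (simp add: psubst_pconst_pvar)
  qed
  moreover have "Poly_Mapping.lookup (bisubst pconst (pvar Y) (pvar X) f) (mon i j) =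
      Poly_Mapping.lookup f (mon j i)" for i j
  proof -
    have *: "bisubst pconst (pvar Y) (pvar X) f = (\<Sum>m\<in>Poly_Mapping.keys f.
        Poly_Mapping.single (mon (Poly_Mapping.lookup m Y) (Poly_Mapping.lookup m X)) (Poly_Mapping.lookup f m))"
      unfolding psubst_eq monom_eval_xy
      by (simp add: pvar_power mult_single pconst_def mon_def add.commute)
    \<comment> \<open>The exchange is injective on monomials, so \<open>mon j i\<close> is the only
      one that contributes at \<open>mon i j\<close>.\<close>
    have "Poly_Mapping.lookup (bisubst pconst (pvar Y) (pvar X) f) (mon i j) =
        (\<Sum>m\<in>Poly_Mapping.keys f. if m = mon j i then Poly_Mapping.lookup f m else 0)"
      unfolding * lookup_sum
    proof (intro sum.cong refl)
      fix m
      have "mon (Poly_Mapping.lookup m Y) (Poly_Mapping.lookup m X) = mon i j \<longleftrightarrow> m = mon j i"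
        by (metis lookup_mon mon_lookup)
      then show "Poly_Mapping.lookup (Poly_Mapping.single (mon (Poly_Mapping.lookup m Y) (Poly_Mapping.lookup m X))
          (Poly_Mapping.lookup f m)) (mon i j) = (if m = mon j i then Poly_Mapping.lookup f m else 0)"
        by (simp add: lookup_single when_def)
    qed
    then show ?thesis
      by (simp add: in_keys_iff)
  qed
  ultimately show ?thesis
    unfolding symmetric_poly_def by (metis poly_eqI_mon)
qed


section \<open>Degrees of local permutation polynomials\<close>

text \<open>For \<open>i = 0\<close> the sum is \<open>q\<close> times \<open>1\<close>. For
  \<open>0 < i < q - 1\<close> the polynomial \<open>x^i - 1\<close> has at most \<open>i\<close>
  roots, so \<open>a ^ i \<noteq> 1\<close> for some nonzero \<open>a\<close>; substituting
  \<open>a * u\<close> for \<open>u\<close> multiplies the sum by \<open>a ^ i\<close>, which forces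
  it to vanish.\<close>

lemma sum_power_eq_0:
  assumes "i < CARD('a) - 1"
  shows "(\<Sum>u\<in>UNIV. (u::'a::{field,finite}) ^ i) = 0"
proof (cases "i = 0")
  case True
  then show ?thesis
    using CHAR_dvd_CARD[where ?'a = 'a] by (simp add: of_nat_eq_0_iff_char_dvd)
next
  case False
  have "\<exists>a::'a. a \<noteq> 0 \<and> a ^ i \<noteq> 1"
  proof (rule ccontr)
    assume "\<nexists>a::'a. a \<noteq> 0 \<and> a ^ i \<noteq> 1"
    then have roots: "UNIV - {0} \<subseteq> {a::'a. poly (Polynomial.monom 1 i - 1) a = 0}"
      by (auto simp: poly_monom)
    have "Polynomial.coeff (Polynomial.monom 1 i - 1 :: 'a poly) i = 1"
      using False by simp
    then have nz: "Polynomial.monom 1 i - 1 \<noteq> (0 :: 'a poly)"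
      by (metis coeff_0 zero_neq_one)
    have "CARD('a) - 1 = card (UNIV - {0 :: 'a})"
      by (simp add: card_Diff_singleton)
    also have "\<dots> \<le> card {a::'a. poly (Polynomial.monom 1 i - 1) a = 0}"
      using roots by (intro card_mono) auto
    also have "\<dots> \<le> Polynomial.degree (Polynomial.monom 1 i - 1 :: 'a poly)"
      using nz by (rule card_poly_roots_bound)
    also have "\<dots> \<le> i"
      by (intro degree_diff_le) (auto simp: degree_monom_le)
    finally show False using assms by simp
  qed
  then obtain a :: 'a where a: "a \<noteq> 0" "a ^ i \<noteq> 1" by blast
  have "(\<Sum>u\<in>UNIV. u ^ i) = (\<Sum>u\<in>UNIV. (a * u) ^ i)"
    by (rule sum.reindex_bij_witness[of _ "\<lambda>u. a * u" "\<lambda>u. u / a"]) (use a in auto)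
  also have "\<dots> = a ^ i * (\<Sum>u\<in>UNIV. u ^ i)"
    by (simp add: power_mult_distrib sum_distrib_left)
  finally show ?thesis using a(2) by simp
qed

text \<open>Each nonzero element contributes \<open>1\<close>, and \<open>q - 1\<close> is
  \<open>-1\<close> in the field.\<close>

lemma sum_power_CARD_minus_1: "(\<Sum>u\<in>UNIV. (u::'a::{field,finite}) ^ (CARD('a) - 1)) = - 1"
proof -
  have "(\<Sum>u\<in>UNIV. (u::'a) ^ (CARD('a) - 1)) = (\<Sum>u\<in>UNIV - {0::'a}. 1)"
    by (rule sum.mono_neutral_cong_right)
      (use CARD_field_ge_2[where ?'a = 'a] power_CARD_minus_1_eq_1[where ?'a = 'a] in
        \<open>auto simp: zero_power_eq\<close>)
  also have "\<dots> = of_nat CARD('a) - 1"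
    using CARD_field_ge_2[where ?'a = 'a] by (simp add: card_Diff_singleton of_nat_diff)
  also have "of_nat CARD('a) = (0 :: 'a)"
    using CHAR_dvd_CARD[where ?'a = 'a] by (simp add: of_nat_eq_0_iff_char_dvd)
  finally show ?thesis by simp
qed

text \<open>By the two power sums, the values add up to \<open>- c (q - 1)\<close>. Those of a
  bijection add up to the power sum with exponent \<open>1\<close>, which vanishes since
  \<open>1 < q - 1\<close>; this is where \<open>q > 2\<close> enters.\<close>

lemma bij_imp_leading_coeff_0:
  fixes c :: "nat \<Rightarrow> 'a::{field,finite}"
  assumes "CARD('a) > 2" "bij (\<lambda>u. \<Sum>i<CARD('a). c i * u ^ i)"
  shows "c (CARD('a) - 1) = 0"
proof -
  have "(\<Sum>u\<in>UNIV. \<Sum>i<CARD('a). c i * u ^ i) = (\<Sum>i<CARD('a). c i * (\<Sum>u\<in>UNIV. u ^ i))"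
    by (subst sum.swap) (simp add: sum_distrib_left)
  also have "\<dots> = (\<Sum>i<CARD('a). if i = CARD('a) - 1 then - c i else 0)"
    by (intro sum.cong refl) (auto simp: sum_power_eq_0 sum_power_CARD_minus_1[simplified])
  also have "\<dots> = - c (CARD('a) - 1)"
    by simp
  finally have "(\<Sum>u\<in>UNIV. \<Sum>i<CARD('a). c i * u ^ i) = - c (CARD('a) - 1)" .
  moreover have "(\<Sum>u\<in>UNIV. \<Sum>i<CARD('a). c i * u ^ i) = (\<Sum>u\<in>UNIV. u ^ 1)"
    using sum.reindex_bij_betw[OF assms(2), of "\<lambda>u. u"] by simp
  moreover have "(\<Sum>u\<in>UNIV. (u::'a) ^ 1) = 0"
    using assms(1) by (intro sum_power_eq_0) simp
  ultimately show ?thesis by simp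
qed

text \<open>A polynomial of degree below \<open>q\<close> with \<open>q\<close> roots is
  zero.\<close>

lemma coeffs_0_if_vanishing:
  fixes c :: "nat \<Rightarrow> 'a::{field,finite}"
  assumes "\<And>w. (\<Sum>j<CARD('a). c j * w ^ j) = 0" "j < CARD('a)"
  shows "c j = 0"
proof -
  define P where "P = (\<Sum>j<CARD('a). Polynomial.monom (c j) j)"
  have "Polynomial.degree P < CARD('a)"
    unfolding P_def by (intro degree_sum_less) (auto intro: le_less_trans[OF degree_monom_le])
  moreover have "poly P w = 0" for w
    using assms(1) by (simp add: P_def poly_sum poly_monom)
  ultimately have "P = 0"
    by (intro poly_eqI_degree[of UNIV]) auto
  moreover have "Polynomial.coeff P j = c j"
    using assms(2) by (simp add: P_def coeff_sum)
  ultimately show ?thesis by simp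
qed

text \<open>For every \<open>w\<close> the coefficient of \<open>u^(q-1)\<close> in
  \<open>f(u, w)\<close> vanishes. It is a polynomial in \<open>w\<close> of degree below
  \<open>q\<close>, so all its coefficients vanish too. The same argument applies with the variables
  exchanged.\<close>

lemma LP_lookup_eq_0:
  fixes f :: "(xy, 'a::{field,finite}) mpoly"
  assumes "CARD('a) > 2" "f \<in> LP" "i > CARD('a) - 2 \<or> j > CARD('a) - 2"
  shows "Poly_Mapping.lookup f (mon i j) = 0"
proof -
  let ?q = "CARD('a)" and ?c = "\<lambda>i j. Poly_Mapping.lookup f (mon i j)"
  have deg: "i < ?q \<and> j < ?q" if "?c i j \<noteq> 0" for i j
    using assms(2) that degree_in_less_iff[of ?q X f] degree_in_less_iff[of ?q Y f] lookup_mon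
    by (metis (no_types, lifting) LP_def mem_Collect_eq zero_less_card_finite)
  have eval: "bisubst (\<lambda>c. c) u w f = (\<Sum>i<?q. \<Sum>j<?q. ?c i j * u ^ i * w ^ j)" for u w
    by (rule peval.bisubst_eq) (rule deg)
  have bij: "bij (\<lambda>u. bisubst (\<lambda>c. c) u a f)" "bij (\<lambda>u. bisubst (\<lambda>c. c) a u f)" for a
    using assms(2) by (auto simp: LP_def)
  have X: "?c (?q - 1) j = 0" if "j < ?q" for j
  proof (rule coeffs_0_if_vanishing[OF _ that])
    fix w
    have "bij (\<lambda>u. \<Sum>i<?q. (\<Sum>j<?q. ?c i j * w ^ j) * u ^ i)"
      using bij(1)[of w] unfolding eval by (simp add: sum_distrib_left mult_ac)
    then show "(\<Sum>j<?q. ?c (?q - 1) j * w ^ j) = 0"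
      by (rule bij_imp_leading_coeff_0[OF assms(1)])
  qed
  have Y: "?c i (?q - 1) = 0" if "i < ?q" for i
  proof (rule coeffs_0_if_vanishing[OF _ that])
    fix u
    have "bij (\<lambda>w. \<Sum>i<?q. \<Sum>j<?q. ?c i j * u ^ i * w ^ j)"
      using bij(2)[of u] unfolding eval .
    also have "(\<lambda>w. \<Sum>i<?q. \<Sum>j<?q. ?c i j * u ^ i * w ^ j) =
        (\<lambda>w. \<Sum>j<?q. (\<Sum>i<?q. ?c i j * u ^ i) * w ^ j)"
      by (subst sum.swap) (simp add: sum_distrib_right)
    finally show "(\<Sum>i<?q. ?c i (?q - 1) * u ^ i) = 0"
      by (rule bij_imp_leading_coeff_0[OF assms(1)])
  qed
  show ?thesis
  proof (rule ccontr)
    assume "?c i j \<noteq> 0"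
    moreover from this have "i < ?q" "j < ?q" using deg by auto
    \<comment> \<open>An exponent above \<open>q - 2\<close> and below \<open>q\<close> can only be
      \<open>q - 1\<close>.\<close>
    moreover from this have "i = ?q - 1 \<or> j = ?q - 1" using assms by linarith
    ultimately show False using X Y by auto
  qed
qed


section \<open>Points and local permutation polynomials\<close>

lemma finite_idx [simp]: "finite (idx TYPE('a::{field,finite}))"
  by (simp add: idx_def)

lemma finite_Xq [simp]: "finite (Xq TYPE('a::{field,finite}))"
  by (simp add: Xq_def)

lemma lookup_poly_of_point:
  fixes s :: "nat \<times> nat \<Rightarrow> 'a::{field,finite}"
  shows "Poly_Mapping.lookup (poly_of_point s) (mon i j) = (if (i, j) \<in> Xq TYPE('a) then s (i, j) else 0)"
proof -
  have "poly_of_point s = (\<Sum>(i, j)\<in>Xq TYPE('a). Poly_Mapping.single (mon i j) (s (i, j)))"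
    unfolding poly_of_point_def Xq_def
    by (simp add: sum.cartesian_product pvar_power pconst_def mult_single mon_def)
  then have "Poly_Mapping.lookup (poly_of_point s) (mon i j) =
      (\<Sum>v\<in>Xq TYPE('a). Poly_Mapping.lookup (Poly_Mapping.single (mon (fst v) (snd v)) (s v)) (mon i j))"
    by (simp add: lookup_sum case_prod_beta)
  also have "\<dots> = (\<Sum>v\<in>Xq TYPE('a). if v = (i, j) then s v else 0)"
    by (intro sum.cong refl) (auto simp: lookup_single when_def)
  finally show ?thesis by simp
qed

lemma bisubst_poly_of_point:
  fixes s :: "nat \<times> nat \<Rightarrow> 'a::{field,finite}"
  shows "bisubst (\<lambda>c. c) u w (poly_of_point s) =
    (\<Sum>i\<in>idx TYPE('a). \<Sum>j\<in>idx TYPE('a). s (i, j) * u ^ i * w ^ j)"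
  unfolding poly_of_point_def
  by (simp add: peval.psubst_sum peval.psubst_mult peval.psubst_power peval.psubst_pconst peval.psubst_pvar)

lemma power_CARD_minus_1_eq_1_iff: "(a::'a::{field,finite}) ^ (CARD('a) - 1) = 1 \<longleftrightarrow> a \<noteq> 0"
  using power_CARD_minus_1_eq_1[of a] CARD_field_ge_2[where ?'a = 'a]
  by (cases "a = 0") (simp add: zero_power_eq, blast)

text \<open>The roots of \<open>x^(q-1) - 1\<close> are exactly the nonzero elements, so
  \<open>F_poly\<close> expresses an inequality of values as an equation.\<close>

lemma peval_F_poly_eq_0_iff: "peval s (F_poly p) = 0 \<longleftrightarrow> peval s p \<noteq> 0"
  unfolding F_poly_def peval.psubst_diff peval.psubst_power peval.psubst_1
  by (simp only: right_minus_eq power_CARD_minus_1_eq_1_iff)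

lemma peval_G_col_eq_0_iff:
  fixes s :: "nat \<times> nat \<Rightarrow> 'a::{field,finite}"
  shows "peval s (G_col a b c) = 0 \<longleftrightarrow>
    bisubst (\<lambda>c. c) a c (poly_of_point s) \<noteq> bisubst (\<lambda>c. c) b c (poly_of_point s)"
proof -
  have diff: "bisubst (\<lambda>c. c) a c (poly_of_point s) - bisubst (\<lambda>c. c) b c (poly_of_point s) =
      (\<Sum>i\<in>idx TYPE('a). \<Sum>j\<in>idx TYPE('a). (a ^ i - b ^ i) * c ^ j * s (i, j))"
    by (simp add: bisubst_poly_of_point algebra_simps flip: sum_subtractf)
  have "peval s (G_col a b c) = 0 \<longleftrightarrow>
      (\<Sum>i\<in>idx TYPE('a). \<Sum>j\<in>idx TYPE('a). (a ^ i - b ^ i) * c ^ j * s (i, j)) \<noteq> 0"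
    unfolding G_col_def peval_F_poly_eq_0_iff
    by (simp add: peval.psubst_sum peval.psubst_mult peval.psubst_pconst peval.psubst_pvar)
  then show ?thesis
    unfolding diff[symmetric] by simp
qed

lemma peval_G_row_eq_0_iff:
  fixes s :: "nat \<times> nat \<Rightarrow> 'a::{field,finite}"
  shows "peval s (G_row a b c) = 0 \<longleftrightarrow>
    bisubst (\<lambda>c. c) c a (poly_of_point s) \<noteq> bisubst (\<lambda>c. c) c b (poly_of_point s)"
proof -
  have "bisubst (\<lambda>c. c) c a (poly_of_point s) - bisubst (\<lambda>c. c) c b (poly_of_point s) =
      (\<Sum>j\<in>idx TYPE('a). \<Sum>i\<in>idx TYPE('a). (a ^ i - b ^ i) * c ^ j * s (j, i))"
    by (simp add: bisubst_poly_of_point algebra_simps flip: sum_subtractf)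
  \<comment> \<open>In \<open>G_row\<close> the outer sum runs over the second index of the
    variable, in \<open>poly_of_point\<close> over the first.\<close>
  also have "\<dots> = (\<Sum>i\<in>idx TYPE('a). \<Sum>j\<in>idx TYPE('a). (a ^ i - b ^ i) * c ^ j * s (j, i))"
    by (rule sum.swap)
  finally have diff: "bisubst (\<lambda>c. c) c a (poly_of_point s) - bisubst (\<lambda>c. c) c b (poly_of_point s) =
      (\<Sum>i\<in>idx TYPE('a). \<Sum>j\<in>idx TYPE('a). (a ^ i - b ^ i) * c ^ j * s (j, i))" .
  have "peval s (G_row a b c) = 0 \<longleftrightarrow>
      (\<Sum>i\<in>idx TYPE('a). \<Sum>j\<in>idx TYPE('a). (a ^ i - b ^ i) * c ^ j * s (j, i)) \<noteq> 0"
    unfolding G_row_def peval_F_poly_eq_0_iff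
    by (simp add: peval.psubst_sum peval.psubst_mult peval.psubst_pconst peval.psubst_pvar)
  then show ?thesis
    unfolding diff[symmetric] by simp
qed

lemma bij_iff_finite: "bij f \<longleftrightarrow> (\<forall>a b. a \<noteq> b \<longrightarrow> f a \<noteq> f b)" for f :: "'a::finite \<Rightarrow> 'a"
  using finite_UNIV_inj_surj[of f] by (auto simp: bij_def inj_def)

text \<open>On a finite field bijectivity amounts to injectivity, which the generators express; the
  degree bounds hold because the exponents stop at \<open>q - 2\<close>.\<close>

lemma poly_of_point_in_LP_iff:
  fixes s :: "nat \<times> nat \<Rightarrow> 'a::{field,finite}"
  shows "poly_of_point s \<in> LP \<longleftrightarrow>
    (\<forall>a b c. a \<noteq> b \<longrightarrow> peval s (G_row a b c) = 0 \<and> peval s (G_col a b c) = 0)"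
proof -
  have "i < CARD('a) \<and> j < CARD('a)" if "(i, j) \<in> Xq TYPE('a)" for i j
    using that CARD_field_ge_2[where ?'a = 'a] by (auto simp: Xq_def idx_def)
  then have "degree_in X (poly_of_point s) < CARD('a)" "degree_in Y (poly_of_point s) < CARD('a)"
    unfolding degree_in_less_iff[OF zero_less_card_finite] all_mon lookup_mon lookup_poly_of_point
    by auto
  then show ?thesis
    unfolding LP_def mem_Collect_eq bij_iff_finite peval_G_row_eq_0_iff peval_G_col_eq_0_iff
    by blast
qed

text \<open>Keeps the degree convention for the zero polynomial from interfering:
  \<open>total_degree_eq_iff\<close> applies to all of \<open>LP\<close>.\<close>

lemma LP_nonzero: "f \<noteq> 0" if "f \<in> LP" for f :: "(xy, 'a::{field,finite}) mpoly"
proof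
  assume "f = 0"
  then have "bij (\<lambda>_ :: 'a. 0 :: 'a)"
    using that by (simp add: LP_def peval.psubst_0)
  then show False
    unfolding bij_iff_finite by (metis zero_neq_one)
qed

text \<open>The coefficients recover a point on \<open>Xq\<close>, and extensionality fixes it
  elsewhere. Conversely, \<open>LP_lookup_eq_0\<close> confines the support of a local permutation
  polynomial to \<open>Xq\<close>, so its coefficients form a point. The set \<open>A\<close> stands
  for \<open>SLP\<close> or \<open>SLP_deg d\<close>.\<close>

lemma bij_betw_poly_of_point:
  fixes A :: "(xy, 'a::{field,finite}) mpoly set"
  assumes "CARD('a) > 2" "A \<subseteq> LP"
  shows "bij_betw poly_of_point {s \<in> Xq TYPE('a) \<rightarrow>\<^sub>E UNIV. poly_of_point s \<in> A} A"
proof (rule bij_betw_imageI)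
  show "inj_on poly_of_point {s \<in> Xq TYPE('a) \<rightarrow>\<^sub>E UNIV. poly_of_point s \<in> A}"
  proof (rule inj_onI, clarify)
    fix s t :: "nat \<times> nat \<Rightarrow> 'a"
    assume st: "s \<in> Xq TYPE('a) \<rightarrow>\<^sub>E UNIV" "t \<in> Xq TYPE('a) \<rightarrow>\<^sub>E UNIV" "poly_of_point s = poly_of_point t"
    have "s (i, j) = t (i, j)" if "(i, j) \<in> Xq TYPE('a)" for i j
      using that st(3) lookup_poly_of_point[of s i j] lookup_poly_of_point[of t i j] by simp
    then show "s = t"
      using st(1,2) by (intro PiE_ext[of s _ "\<lambda>_. UNIV" t]) auto
  qed
  show "poly_of_point ` {s \<in> Xq TYPE('a) \<rightarrow>\<^sub>E UNIV. poly_of_point s \<in> A} = A"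
  proof (intro equalityI subsetI)
    fix f assume f: "f \<in> A"
    define s where "s = (\<lambda>v\<in>Xq TYPE('a). case v of (i, j) \<Rightarrow> Poly_Mapping.lookup f (mon i j))"
    have "poly_of_point s = f"
    proof (rule poly_eqI_mon)
      fix i j
      show "Poly_Mapping.lookup (poly_of_point s) (mon i j) = Poly_Mapping.lookup f (mon i j)"
      proof (cases "(i, j) \<in> Xq TYPE('a)")
        case False
        then have "i > CARD('a) - 2 \<or> j > CARD('a) - 2"
          by (auto simp: Xq_def idx_def)
        then have "Poly_Mapping.lookup f (mon i j) = 0"
          using f assms by (intro LP_lookup_eq_0) auto
        then show ?thesis
          using False by (simp add: lookup_poly_of_point)
      qed (simp add: lookup_poly_of_point s_def)
    qed
    moreover have "s \<in> Xq TYPE('a) \<rightarrow>\<^sub>E UNIV"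
      by (simp add: s_def)
    ultimately show "f \<in> poly_of_point ` {s \<in> Xq TYPE('a) \<rightarrow>\<^sub>E UNIV. poly_of_point s \<in> A}"
      using f by blast
  qed auto
qed


section \<open>The ideals of symmetric local permutation polynomials\<close>

lemma pvars_F_poly: "pvars p \<subseteq> V \<Longrightarrow> pvars (F_poly p) \<subseteq> V"
  unfolding F_poly_def by (intro pvars_subset_intros) auto

lemma pvars_G:
  "pvars (G_row a b c :: (nat \<times> nat, 'a::{field,finite}) mpoly) \<subseteq> Xq TYPE('a)"
  "pvars (G_col a b c :: (nat \<times> nat, 'a::{field,finite}) mpoly) \<subseteq> Xq TYPE('a)"
  unfolding G_row_def G_col_def
  by (intro pvars_F_poly pvars_subset_intros; auto simp: Xq_def)+

abbreviation local_perm_gens :: "(nat \<times> nat, 'a::{field,finite}) mpoly set" where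
  "local_perm_gens \<equiv> {G_row a b c | a b c. a \<noteq> b} \<union> {G_col a b c | a b c. a \<noteq> b}"

abbreviation field_eq_gens :: "(nat \<times> nat, 'a::{field,finite}) mpoly set" where
  "field_eq_gens \<equiv> {pvar (i, j) ^ CARD('a) - pvar (i, j) | i j. (i, j) \<in> Xq TYPE('a)}"

abbreviation high_degree_gens :: "nat \<Rightarrow> (nat \<times> nat, 'a::{field,finite}) mpoly set" where
  "high_degree_gens d \<equiv> {pvar (i, j) | i j. (i, j) \<in> Xq TYPE('a) \<and> i + j > d}"

abbreviation degree_gens :: "nat \<Rightarrow> (nat \<times> nat, 'a::{field,finite}) mpoly set" where
  "degree_gens d \<equiv>
     {\<Prod>(i, j)\<in>{(i, j) \<in> Xq TYPE('a). i + j = d}. (pvar (i, j) ^ (CARD('a) - 1) - 1)}"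

abbreviation sym_gens :: "(nat \<times> nat, 'a::{field,finite}) mpoly set" where
  "sym_gens \<equiv> {pvar (i, j) - pvar (j, i) | i j. (i, j) \<in> Xq TYPE('a) \<and> i < j}"

lemma gens_pvars:
  fixes p :: "(nat \<times> nat, 'a::{field,finite}) mpoly"
  shows "p \<in> local_perm_gens \<Longrightarrow> pvars p \<subseteq> Xq TYPE('a)"
    and "p \<in> field_eq_gens \<Longrightarrow> pvars p \<subseteq> Xq TYPE('a)"
    and "p \<in> high_degree_gens d \<Longrightarrow> pvars p \<subseteq> Xq TYPE('a)"
    and "p \<in> degree_gens d \<Longrightarrow> pvars p \<subseteq> Xq TYPE('a)"
    and "p \<in> sym_gens \<Longrightarrow> pvars p \<subseteq> Xq TYPE('a)"
proof -
  show "p \<in> local_perm_gens \<Longrightarrow> pvars p \<subseteq> Xq TYPE('a)"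
    using pvars_G by blast
  show "p \<in> field_eq_gens \<Longrightarrow> pvars p \<subseteq> Xq TYPE('a)"
    \<comment> \<open>\<open>clarify\<close> descends to single variables;
      \<open>rev_subsetD\<close> restores an inclusion, to which the closure rules for
      \<open>pvars\<close> apply.\<close>
    by (clarify; erule rev_subsetD; intro pvars_subset_intros; simp)
  show "p \<in> high_degree_gens d \<Longrightarrow> pvars p \<subseteq> Xq TYPE('a)"
    by auto
  show "p \<in> degree_gens d \<Longrightarrow> pvars p \<subseteq> Xq TYPE('a)"
    by (simp only: singleton_iff) (intro pvars_prod_subset, clarsimp, erule rev_subsetD,
      intro pvars_subset_intros, simp_all)
  show "p \<in> sym_gens \<Longrightarrow> pvars p \<subseteq> Xq TYPE('a)"
    by (clarify; erule rev_subsetD; intro pvars_subset_intros; simp add: Xq_def)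
qed

lemma ideal_genideal_Rq:
  fixes S :: "(nat \<times> nat, 'a::{field,finite}) mpoly set"
  assumes "\<And>p. p \<in> S \<Longrightarrow> pvars p \<subseteq> Xq TYPE('a)"
  shows "ideal (Idl\<^bsub>Rq\<^esub> S) Rq"
  using assms by (intro ring.genideal_ideal[OF ring_poly_ring]) auto

lemmas ideal_gens = gens_pvars[THEN ideal_genideal_Rq]

lemma ideal_J: "ideal (J :: (nat \<times> nat, 'a::{field,finite}) mpoly set) Rq"
  unfolding J_def by (intro ring.add_ideals[OF ring_poly_ring] ideal_gens)

lemma ideal_J_deg: "ideal (J_deg d :: (nat \<times> nat, 'a::{field,finite}) mpoly set) Rq"
  unfolding J_deg_def by (intro ring.add_ideals[OF ring_poly_ring] ideal_gens ideal_J)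

lemma ideal_Sym_ideal: "ideal (Sym_ideal :: (nat \<times> nat, 'a::{field,finite}) mpoly set) Rq"
  unfolding Sym_ideal_def by (rule ideal_gens)

lemma ideal_SJ: "ideal (SJ :: (nat \<times> nat, 'a::{field,finite}) mpoly set) Rq"
  unfolding SJ_def by (intro ring.add_ideals[OF ring_poly_ring] ideal_J ideal_Sym_ideal)

lemma ideal_SJ_deg: "ideal (SJ_deg d :: (nat \<times> nat, 'a::{field,finite}) mpoly set) Rq"
  unfolding SJ_deg_def by (intro ring.add_ideals[OF ring_poly_ring] ideal_J_deg ideal_Sym_ideal)

lemma field_eq_in_J:
  assumes "v \<in> Xq TYPE('a)"
  shows "pvar v ^ CARD('a) - pvar v \<in> (J :: (nat \<times> nat, 'a::{field,finite}) mpoly set)"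
proof -
  have "pvar v ^ CARD('a) - pvar v \<in> (field_eq_gens :: (nat \<times> nat, 'a) mpoly set)"
    using assms by (cases v) auto
  moreover have "(field_eq_gens :: (nat \<times> nat, 'a) mpoly set) \<subseteq> Idl\<^bsub>Rq\<^esub> field_eq_gens"
    by (intro ring.genideal_self[OF ring_poly_ring] subsetI, unfold carrier_poly_ring) (rule gens_pvars(2))
  moreover have "Idl\<^bsub>Rq\<^esub> field_eq_gens \<subseteq> (J :: (nat \<times> nat, 'a) mpoly set)"
    unfolding J_def by (intro subset_set_add_ideals ideal_gens)
  ultimately show ?thesis by blast
qed

lemma J_subset_J_deg: "(J :: (nat \<times> nat, 'a::{field,finite}) mpoly set) \<subseteq> J_deg d"
proof -
  have "(J :: (nat \<times> nat, 'a) mpoly set) \<subseteq> J <+>\<^bsub>Rq\<^esub> Idl\<^bsub>Rq\<^esub> high_degree_gens d"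
    by (intro subset_set_add_ideals ideal_J ideal_gens)
  also have "\<dots> \<subseteq> J_deg d"
    unfolding J_deg_def
    by (intro subset_set_add_ideals ring.add_ideals[OF ring_poly_ring] ideal_J ideal_gens)
  finally show ?thesis .
qed

lemma J_subset_SJ: "(J :: (nat \<times> nat, 'a::{field,finite}) mpoly set) \<subseteq> SJ"
  unfolding SJ_def by (intro subset_set_add_ideals ideal_J ideal_Sym_ideal)

lemma J_subset_SJ_deg: "(J :: (nat \<times> nat, 'a::{field,finite}) mpoly set) \<subseteq> SJ_deg d"
  using J_subset_J_deg subset_set_add_ideals(1)[OF ideal_J_deg ideal_Sym_ideal]
  unfolding SJ_deg_def by blast

section \<open>Vanishing of the ideals at a point\<close>

lemma vanishes_on_J_iff:
  fixes s :: "nat \<times> nat \<Rightarrow> 'a::{field,finite}"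
  shows "(\<forall>p\<in>J. peval s p = 0) \<longleftrightarrow> poly_of_point s \<in> LP"
proof -
  have "(\<forall>p\<in>J. peval s p = 0) \<longleftrightarrow>
      (\<forall>p\<in>local_perm_gens. peval s p = 0) \<and> (\<forall>p\<in>field_eq_gens. peval s p = 0)"
    unfolding J_def
    by (simp only: vanishes_on_set_add_iff[OF ideal_gens(1,2)]
        vanishes_on_genideal_iff[OF gens_pvars(1)] vanishes_on_genideal_iff[OF gens_pvars(2)])
  \<comment> \<open>Every coordinate satisfies \<open>a ^ q = a\<close>, so the field equations hold
    at all points.\<close>
  also have "(\<forall>p\<in>field_eq_gens. peval s p = 0) \<longleftrightarrow> True"
    by (auto simp: peval.psubst_diff peval.psubst_power peval.psubst_pvar power_CARD_eq_self)
  also have "(\<forall>p\<in>local_perm_gens. peval s p = 0) \<longleftrightarrow> poly_of_point s \<in> LP"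
    unfolding poly_of_point_in_LP_iff by blast
  finally show ?thesis by simp
qed

lemma vanishes_on_Sym_ideal_iff:
  fixes s :: "nat \<times> nat \<Rightarrow> 'a::{field,finite}"
  shows "(\<forall>p\<in>Sym_ideal. peval s p = 0) \<longleftrightarrow> symmetric_poly (poly_of_point s)"
proof -
  have "(\<forall>p\<in>Sym_ideal. peval s p = 0) \<longleftrightarrow> (\<forall>p\<in>sym_gens. peval s p = 0)"
    unfolding Sym_ideal_def by (rule vanishes_on_genideal_iff[OF gens_pvars(5)])
  also have "\<dots> \<longleftrightarrow> (\<forall>i j. (i, j) \<in> Xq TYPE('a) \<and> i < j \<longrightarrow> s (i, j) = s (j, i))"
    by (fastforce simp: peval.psubst_diff peval.psubst_pvar)
  \<comment> \<open>The diagonal is trivial, and \<open>i > j\<close> is the same equation read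
    backwards since \<open>Xq\<close> is closed under transposition.\<close>
  also have "\<dots> \<longleftrightarrow> (\<forall>i j. (i, j) \<in> Xq TYPE('a) \<longrightarrow> s (i, j) = s (j, i))"
  proof (intro iffI allI impI)
    fix i j
    assume "\<forall>i j. (i, j) \<in> Xq TYPE('a) \<and> i < j \<longrightarrow> s (i, j) = s (j, i)" "(i, j) \<in> Xq TYPE('a)"
    then show "s (i, j) = s (j, i)"
      by (cases i j rule: linorder_cases) (auto simp: Xq_def)
  qed auto
  also have "\<dots> \<longleftrightarrow> symmetric_poly (poly_of_point s)"
    unfolding symmetric_poly_iff lookup_poly_of_point by (auto simp: Xq_def)
  finally show ?thesis .
qed

lemma vanishes_on_J_deg_iff:
  fixes s :: "nat \<times> nat \<Rightarrow> 'a::{field,finite}"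
  shows "(\<forall>p\<in>J_deg d. peval s p = 0) \<longleftrightarrow> poly_of_point s \<in> LP_deg d"
proof -
  have "(\<forall>p\<in>J_deg d. peval s p = 0) \<longleftrightarrow> poly_of_point s \<in> LP \<and>
      (\<forall>p\<in>high_degree_gens d. peval s p = 0) \<and> (\<forall>p\<in>degree_gens d. peval s p = 0)"
    unfolding J_deg_def
    by (simp only: vanishes_on_set_add_iff[OF ring.add_ideals[OF ring_poly_ring ideal_J ideal_gens(3)] ideal_gens(4)]
        vanishes_on_set_add_iff[OF ideal_J ideal_gens(3)] vanishes_on_J_iff conj_assoc
        vanishes_on_genideal_iff[OF gens_pvars(3)] vanishes_on_genideal_iff[OF gens_pvars(4)])
  also have "(\<forall>p\<in>high_degree_gens d. peval s p = 0) \<longleftrightarrow>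
      (\<forall>i j. i + j > d \<longrightarrow> Poly_Mapping.lookup (poly_of_point s) (mon i j) = 0)"
    unfolding lookup_poly_of_point by (fastforce simp: peval.psubst_pvar)
  also have "(\<forall>p\<in>degree_gens d. peval s p = 0) \<longleftrightarrow>
      (\<exists>i j. i + j = d \<and> Poly_Mapping.lookup (poly_of_point s) (mon i j) \<noteq> 0)"
  proof -
    have fin: "finite {(i, j) \<in> Xq TYPE('a). i + j = d}"
      by (rule finite_subset[of _ "Xq TYPE('a)"]) auto
    \<comment> \<open>A finite product in a field vanishes iff a factor does, and each factor
      vanishes iff its coordinate is nonzero. If no index pair satisfies \<open>i + j = d\<close>,
      the product is \<open>1\<close> and both sides are false.\<close>
    have "(\<forall>p\<in>degree_gens d. peval s p = 0) \<longleftrightarrow>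
        (\<exists>v\<in>{(i, j) \<in> Xq TYPE('a). i + j = d}. peval s (pvar v ^ (CARD('a) - 1) - 1) = 0)"
      using fin by (simp add: peval.psubst_prod case_prod_beta del: One_nat_def)
    also have "\<dots> \<longleftrightarrow> (\<exists>v\<in>{(i, j) \<in> Xq TYPE('a). i + j = d}. s v \<noteq> 0)"
      by (simp only: peval.psubst_diff peval.psubst_power peval.psubst_pvar peval.psubst_1
          right_minus_eq power_CARD_minus_1_eq_1_iff)
    finally show ?thesis
      unfolding lookup_poly_of_point by auto
  qed
  also have "poly_of_point s \<in> LP \<and>
      (\<forall>i j. i + j > d \<longrightarrow> Poly_Mapping.lookup (poly_of_point s) (mon i j) = 0) \<and>
      (\<exists>i j. i + j = d \<and> Poly_Mapping.lookup (poly_of_point s) (mon i j) \<noteq> 0) \<longleftrightarrow>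
      poly_of_point s \<in> LP_deg d"
    using total_degree_eq_iff[OF LP_nonzero] unfolding LP_deg_def by blast
  finally show ?thesis .
qed

lemma algebraic_set_SJ:
  "algebraic_set (Xq TYPE('a)) (SJ :: (nat \<times> nat, 'a::{field,finite}) mpoly set) =
    {s \<in> Xq TYPE('a) \<rightarrow>\<^sub>E UNIV. poly_of_point s \<in> SLP}"
  unfolding algebraic_set_def SJ_def vanishes_on_set_add_iff[OF ideal_J ideal_Sym_ideal]
    vanishes_on_J_iff vanishes_on_Sym_ideal_iff SLP_def by blast

lemma algebraic_set_SJ_deg:
  "algebraic_set (Xq TYPE('a)) (SJ_deg d :: (nat \<times> nat, 'a::{field,finite}) mpoly set) =
    {s \<in> Xq TYPE('a) \<rightarrow>\<^sub>E UNIV. poly_of_point s \<in> SLP_deg d}"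
  unfolding algebraic_set_def SJ_deg_def vanishes_on_set_add_iff[OF ideal_J_deg ideal_Sym_ideal]
    vanishes_on_J_deg_iff vanishes_on_Sym_ideal_iff SLP_deg_def by blast

theorem proposition3p3:
  assumes "CARD('a::{field,finite}) > 3"
  shows "zero_dimensional_ideal (Xq TYPE('a)) (SJ :: (nat \<times> nat, 'a) mpoly set) \<and>
         radical_ideal Rq (SJ :: (nat \<times> nat, 'a) mpoly set) \<and>
         bij_betw poly_of_point (algebraic_set (Xq TYPE('a)) SJ) (SLP :: (xy, 'a) mpoly set) \<and>
         (\<forall>d. zero_dimensional_ideal (Xq TYPE('a)) (SJ_deg d :: (nat \<times> nat, 'a) mpoly set) \<and>
              radical_ideal Rq (SJ_deg d :: (nat \<times> nat, 'a) mpoly set) \<and>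
              bij_betw poly_of_point (algebraic_set (Xq TYPE('a)) (SJ_deg d))
                (SLP_deg d :: (xy, 'a) mpoly set))"
proof -
  \<comment> \<open>The field equations pass from \<open>J\<close> to every larger ideal, which
    makes the results of the locale available for both symmetric ideals.\<close>
  have feq: "field_equations_ideal (Xq TYPE('a)) I"
    if "ideal I Rq" "J \<subseteq> I" for I :: "(nat \<times> nat, 'a) mpoly set"
    using that field_eq_in_J
    by (intro field_equations_ideal.intro field_equations_ideal_axioms.intro) auto
  note SJ = feq[OF ideal_SJ J_subset_SJ] and SJ_deg = feq[OF ideal_SJ_deg J_subset_SJ_deg]
  have sub: "(SLP :: (xy, 'a) mpoly set) \<subseteq> LP" "(SLP_deg d :: (xy, 'a) mpoly set) \<subseteq> LP" for d
    by (auto simp: SLP_def SLP_deg_def LP_deg_def)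
  show ?thesis
    unfolding algebraic_set_SJ algebraic_set_SJ_deg
    using field_equations_ideal.zero_dimensional_ideal[OF SJ]
      field_equations_ideal.radical_ideal[OF SJ]
      field_equations_ideal.zero_dimensional_ideal[OF SJ_deg]
      field_equations_ideal.radical_ideal[OF SJ_deg]
      bij_betw_poly_of_point[OF _ sub(1)] bij_betw_poly_of_point[OF _ sub(2)] assms
    by auto
qed

end
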